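(* Let $0<s<1$, let $\Omega\subset\mathbb{R}^N$ be a bounded domain, and let $\Sigma_1,\Sigma_2$ be two open sets of positive measure with $\Sigma_1\cap\Sigma_2=\emptyset$ and $\overline{\Sigma_1}\cup\overline{\Sigma_2}=\mathbb{R}^N\setminus\Omega$. Let $\overline{\xi_0}$ be the solution of the mixed problem $$(-\Delta)^s\overline{\xi_0}=1\ \text{in }\Omega,\qquad \overline{\xi_0}=0\ \text{in }\Sigma_1,\qquad \mathcal{N}_s\overline{\xi_0}=0\ \text{in }\Sigma_2.$$ Then there is a function $c(t)$, depending on $N$, $s$, $\Omega$, $\Sigma_1$ and $\Sigma_2$, with $c(t)>0$ for $t>0$, such that for every $u_0\in L^2(\Omega)$ with $u_0\geq 0$, the solution $u$ of $$\begin{cases}u_t+(-\Delta)^s u=0 & \text{in }\Omega\times(0,+\infty),\\ u\geq 0 & \text{in }\mathbb{R}^N,\\ u=0 & \text{in }\Sigma_1\times(0,+\infty),\\ \mathcal{N}_s u=0 & \text{in }\Sigma_2\times(0,+\infty),\\ u(x,0)=u_0(x) & \text{in }\Omega,\end{cases}$$ satisfies $$u(x,t)\geq c(t)\left(\int_\Omega u_0(y)\,\overline{\xi_0}(y)\,dy\right)\overline{\xi_0}(x),\qquad (x,t)\in\Omega\times(0,+\infty).$$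
   Context: The fractional Laplacian is $(-\Delta)^s u(x)=a_{N,s}\,\mathrm{P.V.}\int_{\mathbb{R}^N}\frac{u(x)-u(y)}{|x-y|^{N+2s}}\,dy$, with $a_{N,s}>0$ the usual normalization constant, and the nonlocal normal derivative is $\mathcal{N}_s u(x)=a_{N,s}\int_\Omega\frac{u(x)-u(y)}{|x-y|^{N+2s}}\,dy$ for $x\in\mathbb{R}^N\setminus\overline{\Omega}$. Let $Q:=\mathbb{R}^{2N}\setminus(\mathbb{R}^N\setminus\Omega)^2$ and let $E^s_{\Sigma_1}$ be the space of measurable $u:\mathbb{R}^N\to\mathbb{R}$ with $u=0$ in $\Sigma_1$ and $$\|u\|_{E^s_{\Sigma_1}}^2:=\int_\Omega u^2\,dx+\iint_Q\frac{|u(x)-u(y)|^2}{|x-y|^{N+2s}}\,dx\,dy<+\infty .$$ Elliptic problem: $\overline{\xi_0}$ is the unique element of $E^s_{\Sigma_1}$ with $$\frac{a_{N,s}}{2}\iint_Q\frac{(\overline{\xi_0}(x)-\overline{\xi_0}(y))(\varphi(x)-\varphi(y))}{|x-y|^{N+2s}}\,dx\,dy=\int_\Omega \varphi\,dx\qquad\text{for every }\varphi\in E^s_{\Sigma_1}.$$ Parabolic problem: the solution is $u=S(t)u_0$, where $\{S(t)\}_{t\geq0}$ is the analytic semigroup in $L^2(\Omega)$ of the fractional heat equation with these mixed boundary conditions; it is the unique $u\in\mathcal{C}([0,\infty);L^2(\Omega))\cap\mathcal{C}((0,\infty);E^s_{\Sigma_1})\cap\mathcal{C}^1((0,\infty);L^2(\Omega))$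 with $u(\cdot,0)=u_0$ and, for every $\tau>0$ and $\varphi\in\mathcal{C}((0,\infty);E^s_{\Sigma_1})$, $$\int_\Omega u_t(x,\tau)\varphi(x,\tau)\,dx+\frac{a_{N,s}}{2}\iint_Q\frac{(u(x,\tau)-u(y,\tau))(\varphi(x,\tau)-\varphi(y,\tau))}{|x-y|^{N+2s}}\,dx\,dy=0.$$ Functions of $x$ are identified up to a.e. equality, and pointwise inequalities are understood accordingly. *)

theory Defs
  imports "HOL-Analysis.Analysis"
begin

text \<open>
  The ambient space is a type of class \<^class>\<open>euclidean_space\<close>; its dimension \<open>DIM('a)\<close> is \<open>N\<close>.
  Functions are honest functions; identification up to null sets is expressed by \<open>AE\<close> quantifiers.
\<close>

text \<open>The usual constant, equal to the inverse of the integral of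
  \<open>(1 - cos \<xi>\<^sub>1) / |\<xi>| powr (N + 2 * s)\<close> over the whole space.\<close>

definition frac_const :: "nat \<Rightarrow> real \<Rightarrow> real" where
  "frac_const N s = 4 powr s * Gamma (real N / 2 + s) / (pi powr (real N / 2) * \<bar>Gamma (- s)\<bar>)"

text \<open>On the diagonal the denominator is \<open>0 powr _ = 0\<close>, so the kernel takes the value 0 there;
  the diagonal is a null set.\<close>

definition frac_kernel :: "real \<Rightarrow> 'a::euclidean_space \<Rightarrow> 'a \<Rightarrow> real" where
  "frac_kernel s x y = 1 / norm (x - y) powr (real DIM('a) + 2 * s)"

definition Q_set :: "'a set \<Rightarrow> ('a \<times> 'a) set" where
  "Q_set \<Omega> = UNIV - (UNIV - \<Omega>) \<times> (UNIV - \<Omega>)"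

text \<open>\<open>lebesgue\<close> is sigma-finite, so \<open>lebesgue \<Otimes>\<^sub>M lebesgue\<close> is the genuine product measure
  (Lebesgue measure on a sub-sigma-algebra that contains the Borel sets).\<close>

lemma sigma_finite_lebesgue: "sigma_finite_measure (lebesgue :: 'a::euclidean_space measure)"
proof
  obtain A :: "'a set set" where A: "countable A" "A \<subseteq> sets lborel" "\<Union>A = space lborel"
      "\<forall>a\<in>A. emeasure lborel a \<noteq> \<infinity>"
    using lborel.sigma_finite_countable by blast
  then show "\<exists>A::'a set set. countable A \<and> A \<subseteq> sets lebesgue \<and> \<Union>A = space lebesgue \<and>
      (\<forall>a\<in>A. emeasure lebesgue a \<noteq> \<infinity>)"
    by (intro exI[of _ A]) (auto simp: subset_iff)
qed

definition L2 :: "'a::euclidean_space set \<Rightarrow> ('a \<Rightarrow> real) set" where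
  "L2 \<Omega> = {u \<in> borel_measurable (lebesgue_on \<Omega>). integrable (lebesgue_on \<Omega>) (\<lambda>x. (u x)\<^sup>2)}"

definition L2_normsq :: "'a::euclidean_space set \<Rightarrow> ('a \<Rightarrow> real) \<Rightarrow> ennreal" where
  "L2_normsq \<Omega> u = (\<integral>\<^sup>+x. ennreal ((u x)\<^sup>2) \<partial>lebesgue_on \<Omega>)"

definition E_normsq :: "real \<Rightarrow> 'a::euclidean_space set \<Rightarrow> ('a \<Rightarrow> real) \<Rightarrow> ennreal" where
  "E_normsq s \<Omega> u = L2_normsq \<Omega> u +
     (\<integral>\<^sup>+p\<in>Q_set \<Omega>. ennreal ((u (fst p) - u (snd p))\<^sup>2 * frac_kernel s (fst p) (snd p))
        \<partial>(lebesgue \<Otimes>\<^sub>M lebesgue))"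

definition E_space :: "real \<Rightarrow> 'a::euclidean_space set \<Rightarrow> 'a set \<Rightarrow> ('a \<Rightarrow> real) set" where
  "E_space s \<Omega> \<Sigma>1 = {u \<in> borel_measurable lebesgue.
     (AE x in lebesgue. x \<in> \<Sigma>1 \<longrightarrow> u x = 0) \<and> E_normsq s \<Omega> u < \<infinity>}"

definition E_form ::
  "real \<Rightarrow> 'a::euclidean_space set \<Rightarrow> ('a \<Rightarrow> real) \<Rightarrow> ('a \<Rightarrow> real) \<Rightarrow> real" where
  "E_form s \<Omega> u v = frac_const DIM('a) s / 2 *
     (LINT p:Q_set \<Omega>|lebesgue \<Otimes>\<^sub>M lebesgue.
        (u (fst p) - u (snd p)) * (v (fst p) - v (snd p)) * frac_kernel s (fst p) (snd p))"

text \<open>Weak solutions of the elliptic mixed problem with right-hand side 1. The condition on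
  \<open>\<Sigma>\<^sub>1\<close> is part of the space; the condition \<open>\<N>\<^sub>s \<xi> = 0\<close> in \<open>\<Sigma>\<^sub>2\<close> is the natural boundary condition
  encoded by testing with functions that need not vanish outside \<open>\<Omega> \<union> \<Sigma>\<^sub>1\<close>. This is why
  \<open>\<Sigma>\<^sub>2\<close> is not a parameter.\<close>

definition elliptic_solution ::
  "real \<Rightarrow> 'a::euclidean_space set \<Rightarrow> 'a set \<Rightarrow> ('a \<Rightarrow> real) \<Rightarrow> bool" where
  "elliptic_solution s \<Omega> \<Sigma>1 \<xi> \<longleftrightarrow> \<xi> \<in> E_space s \<Omega> \<Sigma>1 \<and>
     (\<forall>\<phi>\<in>E_space s \<Omega> \<Sigma>1. E_form s \<Omega> \<xi> \<phi> = (LINT x|lebesgue_on \<Omega>. \<phi> x))"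

text \<open>\<open>curve_cont T X n u\<close>: the map \<open>u\<close> is continuous from \<open>T\<close> to \<open>X\<close>, where \<open>n\<close> is the square of
  the norm of \<open>X\<close>.\<close>

definition curve_cont ::
  "real set \<Rightarrow> ('a \<Rightarrow> real) set \<Rightarrow> (('a \<Rightarrow> real) \<Rightarrow> ennreal) \<Rightarrow> (real \<Rightarrow> 'a \<Rightarrow> real) \<Rightarrow> bool" where
  "curve_cont T X n u \<longleftrightarrow> (\<forall>t\<in>T. u t \<in> X) \<and>
     (\<forall>t\<in>T. ((\<lambda>r. n (\<lambda>x. u r x - u t x)) \<longlongrightarrow> 0) (at t within T))"

definition L2_curve_deriv ::
  "'a::euclidean_space set \<Rightarrow> (real \<Rightarrow> 'a \<Rightarrow> real) \<Rightarrow> ('a \<Rightarrow> real) \<Rightarrow> real \<Rightarrow> bool" where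
  "L2_curve_deriv \<Omega> u d t \<longleftrightarrow>
     ((\<lambda>h. L2_normsq \<Omega> (\<lambda>x. (u (t + h) x - u t x) / h - d x)) \<longlongrightarrow> 0) (at 0)"

text \<open>Here \<open>u t\<close> is the function \<open>u(\<cdot>,t)\<close> and \<open>ut\<close> is its time derivative in \<open>L\<^sup>2(\<Omega>)\<close>.
  Only the values of \<open>u 0\<close> on \<open>\<Omega>\<close> matter. For \<open>u0 \<ge> 0\<close> the sign condition \<open>u \<ge> 0\<close> is a consequence
  (the semigroup preserves positivity) and is not imposed.\<close>

definition parabolic_solution ::
  "real \<Rightarrow> 'a::euclidean_space set \<Rightarrow> 'a set \<Rightarrow> ('a \<Rightarrow> real) \<Rightarrow> (real \<Rightarrow> 'a \<Rightarrow> real) \<Rightarrow> bool" where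
  "parabolic_solution s \<Omega> \<Sigma>1 u0 u \<longleftrightarrow>
     curve_cont {0..} (L2 \<Omega>) (L2_normsq \<Omega>) u \<and>
     curve_cont {0<..} (E_space s \<Omega> \<Sigma>1) (E_normsq s \<Omega>) u \<and>
     (AE x in lebesgue_on \<Omega>. u 0 x = u0 x) \<and>
     (\<exists>ut. curve_cont {0<..} (L2 \<Omega>) (L2_normsq \<Omega>) ut \<and>
        (\<forall>t>0. L2_curve_deriv \<Omega> u (ut t) t) \<and>
        (\<forall>\<tau>>0. \<forall>\<phi>. curve_cont {0<..} (E_space s \<Omega> \<Sigma>1) (E_normsq s \<Omega>) \<phi> \<longrightarrow>
           (LINT x|lebesgue_on \<Omega>. ut \<tau> x * \<phi> \<tau> x) + E_form s \<Omega> (u \<tau>) (\<phi> \<tau>) = 0))"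

end

theory Submission
  imports Defs
begin

text \<open>
  Jumps make the estimate elementary: the bounded set \<open>\<Omega>\<close> and a bounded piece \<open>S\<close> of
  \<open>\<Sigma>\<^sub>1\<close> have positive measure, and the kernel is at least some \<open>\<kappa> > 0\<close> between points of
  \<open>\<Omega>\<close> and points of \<open>\<Omega> \<union> S\<close>. With \<open>\<beta> = c \<kappa> / 2\<close>, where \<open>c\<close> is the constant of the
  fractional Laplacian, this has three consequences.

  Jumps to \<open>S\<close> kill at a positive rate. Hence the form \<open>\<E>\<close> is definite, and testing the elliptic
  equation with \<open>\<xi>\<^sup>-\<close> and with \<open>(\<xi> - C)\<^sup>+\<close>, where \<open>C = 1 / (\<beta> |S|)\<close>, gives \<open>0 \<le> \<xi> \<le> C\<close> (\<open>form_killing\<close>,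
  \<open>elliptic_bounded\<close>).

  Jumps inside \<open>\<Omega>\<close> spread mass instantly: \<open>\<E>(v, v\<^sup>+) \<ge> \<beta> \<integral>v\<^sup>- \<integral>v\<^sup>+\<close>
  (\<open>form_pos_part_ge\<close>). If \<open>v = a t \<xi> - u(t)\<close>, then \<open>\<integral>v\<^sup>- \<ge> \<integral>u(t) - a t \<integral>\<xi>\<close>, while the equations
  give \<open>d/dt \<parallel>v\<^sup>+\<parallel>\<^sup>2 / 2 = a \<integral>\<xi> v\<^sup>+ + a t \<integral>v\<^sup>+ - \<E>(v, v\<^sup>+)\<close>. This is nonpositive on \<open>[0, T]\<close> as
  soon as \<open>a\<close> is a small multiple of the minimal mass \<open>\<integral>u(t)\<close> on that interval, and then \<open>v\<^sup>+ = 0\<close>,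
  that is \<open>u(t) \<ge> a t \<xi>\<close> (\<open>solution_ge\<close>). So a lower bound for the mass in terms of
  \<open>\<integral>u\<^sub>0 \<xi>\<close> suffices.

  That bound (\<open>mass_ge\<close>) comes from the moments \<open>m = \<integral>u\<close>, \<open>f = \<integral>u \<xi>\<close> and \<open>p = \<integral>u \<xi>\<^sup>2\<close>. Testing with
  \<open>\<xi>\<close> gives \<open>f' = -m\<close>: where the mass is large, \<open>f\<close> drops. Testing with \<open>\<xi>\<^sup>2\<close> compensates for this,
  because \<open>(-\<Delta>)\<^sup>s \<xi>\<^sup>2\<close> is \<open>2 \<xi>\<close> minus a square term which, by jumps inside \<open>\<Omega>\<close>, is at
  least \<open>2 \<gamma> - \<beta> |\<Omega>| \<xi>\<^sup>2\<close> with \<open>\<gamma> = \<beta> \<parallel>\<xi>\<parallel>\<^sup>2 / 4\<close>. Thus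
  \<open>p' \<ge> -2 f + 2 \<gamma> m - \<beta> |\<Omega>| p\<close>, and \<open>2 f \<le> p / \<gamma> + \<gamma> m\<close> leads to
  \<open>(p + \<gamma> f)' \<ge> -\<lambda> (p + \<gamma> f)\<close> with \<open>\<lambda> = 1 / \<gamma> + \<beta> |\<Omega>|\<close>. Since
  \<open>\<xi>\<close> is bounded, \<open>p + \<gamma> f\<close> is at most a constant times \<open>m\<close>, while it is at least \<open>\<gamma> \<integral>u\<^sub>0 \<xi>\<close> initially.
\<close>

section \<open>Curves in \<open>L\<^sup>2\<close>\<close>

lemma square_add_le: "(a + b)\<^sup>2 \<le> 2 * a\<^sup>2 + 2 * b\<^sup>2" for a b :: real
  using sum_squares_bound[of a b] by (simp add: power2_sum)

lemma abs_mult_le: "\<bar>a * b\<bar> \<le> a\<^sup>2 + b\<^sup>2" for a b :: real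
proof -
  have "2 * \<bar>a\<bar> * \<bar>b\<bar> \<le> \<bar>a\<bar>\<^sup>2 + \<bar>b\<bar>\<^sup>2" by (rule sum_squares_bound)
  moreover have "0 \<le> \<bar>a\<bar> * \<bar>b\<bar>" by simp
  ultimately show ?thesis unfolding abs_mult power2_abs by linarith
qed

lemma L2_measurable: "u \<in> L2 \<Omega> \<Longrightarrow> u \<in> borel_measurable (lebesgue_on \<Omega>)"
  and L2_integrable_square: "u \<in> L2 \<Omega> \<Longrightarrow> integrable (lebesgue_on \<Omega>) (\<lambda>x. (u x)\<^sup>2)"
  by (auto simp: L2_def)

lemma L2_dominated:
  assumes "v \<in> borel_measurable (lebesgue_on \<Omega>)" "u \<in> L2 \<Omega>"
    and "AE x in lebesgue_on \<Omega>. \<bar>v x\<bar> \<le> C * \<bar>u x\<bar>"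
  shows "v \<in> L2 \<Omega>"
proof -
  have "integrable (lebesgue_on \<Omega>) (\<lambda>x. (v x)\<^sup>2)"
  proof (rule Bochner_Integration.integrable_bound)
    show "integrable (lebesgue_on \<Omega>) (\<lambda>x. C\<^sup>2 * (u x)\<^sup>2)"
      using assms(2) by (simp add: L2_def)
    show "AE x in lebesgue_on \<Omega>. norm ((v x)\<^sup>2) \<le> norm (C\<^sup>2 * (u x)\<^sup>2)"
      using assms(3)
    proof eventually_elim
      case (elim x)
      then have "\<bar>v x\<bar>\<^sup>2 \<le> (C * \<bar>u x\<bar>)\<^sup>2"
        by (intro power_mono) auto
      then show ?case
        by (simp add: power_mult_distrib)
    qed
  qed (use assms(1) in measurable)
  with assms(1) show ?thesis
    by (simp add: L2_def)
qed

lemma L2_mult_integrable: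
  assumes "u \<in> L2 \<Omega>" "v \<in> L2 \<Omega>"
  shows "integrable (lebesgue_on \<Omega>) (\<lambda>x. u x * v x)"
proof (rule Bochner_Integration.integrable_bound)
  show "integrable (lebesgue_on \<Omega>) (\<lambda>x. (u x)\<^sup>2 + (v x)\<^sup>2)"
    using assms by (auto simp: L2_def)
  show "(\<lambda>x. u x * v x) \<in> borel_measurable (lebesgue_on \<Omega>)"
    using assms by (auto simp: L2_def)
  show "AE x in lebesgue_on \<Omega>. norm (u x * v x) \<le> norm ((u x)\<^sup>2 + (v x)\<^sup>2)"
    using abs_mult_le by auto
qed

lemma L2_add_scaled:
  assumes "u \<in> L2 \<Omega>" "v \<in> L2 \<Omega>"
  shows "(\<lambda>x. a * u x + b * v x) \<in> L2 \<Omega>"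
proof -
  have "integrable (lebesgue_on \<Omega>) (\<lambda>x. a\<^sup>2 * (u x)\<^sup>2 + 2 * a * b * (u x * v x) + b\<^sup>2 * (v x)\<^sup>2)"
    using assms L2_mult_integrable[OF assms] by (auto simp: L2_def)
  moreover have "(\<lambda>x. a\<^sup>2 * (u x)\<^sup>2 + 2 * a * b * (u x * v x) + b\<^sup>2 * (v x)\<^sup>2) = (\<lambda>x. (a * u x + b * v x)\<^sup>2)"
    by (auto simp: power2_eq_square algebra_simps)
  ultimately show ?thesis
    using assms by (auto simp: L2_def)
qed

lemma L2_diff: "u \<in> L2 \<Omega> \<Longrightarrow> v \<in> L2 \<Omega> \<Longrightarrow> (\<lambda>x. u x - v x) \<in> L2 \<Omega>"
  using L2_add_scaled[of u \<Omega> v 1 "-1"] by simp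

lemma L2_Cauchy_Schwarz:
  assumes u: "u \<in> L2 \<Omega>" and v: "v \<in> L2 \<Omega>"
  shows "(LINT x|lebesgue_on \<Omega>. u x * v x)\<^sup>2
           \<le> (LINT x|lebesgue_on \<Omega>. (u x)\<^sup>2) * (LINT x|lebesgue_on \<Omega>. (v x)\<^sup>2)"
proof -
  define A B C where "A = (LINT x|lebesgue_on \<Omega>. (u x)\<^sup>2)"
    and "B = (LINT x|lebesgue_on \<Omega>. (v x)\<^sup>2)" and "C = (LINT x|lebesgue_on \<Omega>. u x * v x)"
  have quad: "0 \<le> t\<^sup>2 * A + 2 * t * C + B" for t
  proof -
    have "0 \<le> (LINT x|lebesgue_on \<Omega>. (t * u x + v x)\<^sup>2)"
      by simp
    also have "\<dots> = (LINT x|lebesgue_on \<Omega>. t\<^sup>2 * (u x)\<^sup>2 + 2 * t * (u x * v x) + (v x)\<^sup>2)"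
      by (rule Bochner_Integration.integral_cong) (auto simp: power2_eq_square algebra_simps)
    also have "\<dots> = t\<^sup>2 * A + 2 * t * C + B"
      using L2_integrable_square[OF u] L2_integrable_square[OF v] L2_mult_integrable[OF u v]
      by (simp add: A_def B_def C_def)
    finally show ?thesis .
  qed
  have "A \<ge> 0"
    by (simp add: A_def)
  have "C\<^sup>2 \<le> A * B"
  proof (cases "A = 0")
    case True
    have "C = 0"
    proof (rule ccontr)
      assume "C \<noteq> 0"
      then show False
        using quad[of "- (B + 1) / (2 * C)"] True by (simp add: field_simps)
    qed
    with True show ?thesis by simp
  next
    case False
    with \<open>A \<ge> 0\<close> have "A > 0" by simp
    have "0 \<le> A * ((- C / A)\<^sup>2 * A + 2 * (- C / A) * C + B)"
      using quad[of "- C / A"] \<open>A > 0\<close> by simp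
    also have "\<dots> = A * B - C\<^sup>2"
      using \<open>A > 0\<close> by (simp add: field_simps power2_eq_square)
    finally show ?thesis by simp
  qed
  then show ?thesis
    by (simp add: A_def B_def C_def)
qed

lemma L2_normsq_eq:
  assumes "u \<in> L2 \<Omega>"
  shows "L2_normsq \<Omega> u = ennreal (LINT x|lebesgue_on \<Omega>. (u x)\<^sup>2)"
  unfolding L2_normsq_def using assms by (intro nn_integral_eq_integral) (auto simp: L2_def)

lemma tendsto_L2_square:
  assumes "((\<lambda>r. L2_normsq \<Omega> (v r)) \<longlongrightarrow> 0) F" "\<forall>\<^sub>F r in F. v r \<in> L2 \<Omega>"
  shows "((\<lambda>r. LINT x|lebesgue_on \<Omega>. (v r x)\<^sup>2) \<longlongrightarrow> 0) F"
proof (rule tendsto_ennrealD)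
  show "((\<lambda>r. ennreal (LINT x|lebesgue_on \<Omega>. (v r x)\<^sup>2)) \<longlongrightarrow> ennreal 0) F"
    using assms(1) by (rule Lim_transform_eventually[THEN back_subst[of "\<lambda>l. (_ \<longlongrightarrow> l) F"]])
      (use assms(2) in \<open>auto elim!: eventually_mono simp: L2_normsq_eq\<close>)
qed auto

lemma tendsto_L2_product:
  assumes lim: "((\<lambda>r. L2_normsq \<Omega> (v r)) \<longlongrightarrow> 0) F" and ev: "\<forall>\<^sub>F r in F. v r \<in> L2 \<Omega>"
    and \<phi>: "\<phi> \<in> L2 \<Omega>"
  shows "((\<lambda>r. LINT x|lebesgue_on \<Omega>. v r x * \<phi> x) \<longlongrightarrow> 0) F"
proof -
  have "((\<lambda>r. (LINT x|lebesgue_on \<Omega>. v r x * \<phi> x)\<^sup>2) \<longlongrightarrow> 0) F"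
  proof (rule tendsto_sandwich[where f = "\<lambda>_. 0"])
    show "\<forall>\<^sub>F r in F. (LINT x|lebesgue_on \<Omega>. v r x * \<phi> x)\<^sup>2
       \<le> (LINT x|lebesgue_on \<Omega>. (v r x)\<^sup>2) * (LINT x|lebesgue_on \<Omega>. (\<phi> x)\<^sup>2)"
      using ev by eventually_elim (rule L2_Cauchy_Schwarz[OF _ \<phi>])
    show "((\<lambda>r. (LINT x|lebesgue_on \<Omega>. (v r x)\<^sup>2) * (LINT x|lebesgue_on \<Omega>. (\<phi> x)\<^sup>2)) \<longlongrightarrow> 0) F"
      by (intro tendsto_mult_left_zero tendsto_L2_square lim ev)
  qed auto
  then show ?thesis
    by simp
qed

lemma curve_product_continuous:
  assumes "curve_cont {0..} (L2 \<Omega>) (L2_normsq \<Omega>) u" "\<phi> \<in> L2 \<Omega>"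
  shows "continuous_on {0..} (\<lambda>t. LINT x|lebesgue_on \<Omega>. u t x * \<phi> x)"
  unfolding continuous_on_def
proof
  fix t :: real assume t: "t \<in> {0..}"
  have mem: "u r \<in> L2 \<Omega>" if "r \<in> {0..}" for r
    using assms(1) that by (auto simp: curve_cont_def)
  have "((\<lambda>r. LINT x|lebesgue_on \<Omega>. (u r x - u t x) * \<phi> x) \<longlongrightarrow> 0) (at t within {0..})"
  proof (rule tendsto_L2_product[OF _ _ assms(2)])
    show "((\<lambda>r. L2_normsq \<Omega> (\<lambda>x. u r x - u t x)) \<longlongrightarrow> 0) (at t within {0..})"
      using assms(1) t by (auto simp: curve_cont_def)
    show "\<forall>\<^sub>F r in at t within {0..}. (\<lambda>x. u r x - u t x) \<in> L2 \<Omega>"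
      using mem t by (auto simp: eventually_at_filter intro!: L2_diff always_eventually)
  qed
  then have "((\<lambda>r. (LINT x|lebesgue_on \<Omega>. u r x * \<phi> x) - (LINT x|lebesgue_on \<Omega>. u t x * \<phi> x)) \<longlongrightarrow> 0)
      (at t within {0..})"
  proof (rule Lim_transform_eventually)
    show "\<forall>\<^sub>F r in at t within {0..}. (LINT x|lebesgue_on \<Omega>. (u r x - u t x) * \<phi> x) =
        (LINT x|lebesgue_on \<Omega>. u r x * \<phi> x) - (LINT x|lebesgue_on \<Omega>. u t x * \<phi> x)"
      using L2_mult_integrable[OF mem assms(2)] t
      by (auto simp: eventually_at_filter left_diff_distrib intro!: always_eventually)
  qed
  then show "((\<lambda>t. LINT x|lebesgue_on \<Omega>. u t x * \<phi> x) \<longlongrightarrow> (LINT x|lebesgue_on \<Omega>. u t x * \<phi> x)) (at t within {0..})"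
    by (simp add: LIM_zero_iff)
qed

lemma eventually_add_pos: "0 < t \<Longrightarrow> \<forall>\<^sub>F h in at 0. 0 < t + (h::real)"
  by (auto simp: eventually_at intro!: exI[of _ t] simp: dist_real_def)

lemma curve_product_deriv:
  assumes mem: "\<And>r. 0 < r \<Longrightarrow> u r \<in> L2 \<Omega>" and d: "d \<in> L2 \<Omega>" and \<phi>: "\<phi> \<in> L2 \<Omega>"
    and t: "0 < t" and deriv: "L2_curve_deriv \<Omega> u d t"
  shows "((\<lambda>r. LINT x|lebesgue_on \<Omega>. u r x * \<phi> x) has_real_derivative
            (LINT x|lebesgue_on \<Omega>. d x * \<phi> x)) (at t)"
  unfolding DERIV_def
proof -
  have quot: "(\<lambda>x. (u (t + h) x - u t x) / h - d x) \<in> L2 \<Omega>" if "0 < t + h" for h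
    using L2_diff[OF L2_add_scaled[OF mem[OF that] mem[OF t], of "1/h" "-1/h"] d]
    by (simp add: diff_divide_distrib)
  have "((\<lambda>h. LINT x|lebesgue_on \<Omega>. ((u (t + h) x - u t x) / h - d x) * \<phi> x) \<longlongrightarrow> 0) (at 0)"
    using deriv eventually_mono[OF eventually_add_pos[OF t] quot]
    by (intro tendsto_L2_product \<phi>) (auto simp: L2_curve_deriv_def)
  then have "((\<lambda>h. ((LINT x|lebesgue_on \<Omega>. u (t + h) x * \<phi> x) - (LINT x|lebesgue_on \<Omega>. u t x * \<phi> x)) / h
      - (LINT x|lebesgue_on \<Omega>. d x * \<phi> x)) \<longlongrightarrow> 0) (at 0)"
  proof (rule Lim_transform_eventually)
    show "\<forall>\<^sub>F h in at 0. (LINT x|lebesgue_on \<Omega>. ((u (t + h) x - u t x) / h - d x) * \<phi> x) =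
      ((LINT x|lebesgue_on \<Omega>. u (t + h) x * \<phi> x) - (LINT x|lebesgue_on \<Omega>. u t x * \<phi> x)) / h
      - (LINT x|lebesgue_on \<Omega>. d x * \<phi> x)"
      using eventually_add_pos[OF t]
    proof eventually_elim
      case (elim h)
      have "(LINT x|lebesgue_on \<Omega>. ((u (t + h) x - u t x) / h - d x) * \<phi> x)
          = (LINT x|lebesgue_on \<Omega>. (u (t + h) x * \<phi> x - u t x * \<phi> x) / h - d x * \<phi> x)"
        by (rule Bochner_Integration.integral_cong) (auto simp: algebra_simps diff_divide_distrib)
      then show ?case
        using L2_mult_integrable[OF mem[OF elim] \<phi>] L2_mult_integrable[OF mem[OF t] \<phi>]
          L2_mult_integrable[OF d \<phi>] by simp
    qed
  qed
  then show "((\<lambda>h. ((LINT x|lebesgue_on \<Omega>. u (t + h) x * \<phi> x) - (LINT x|lebesgue_on \<Omega>. u t x * \<phi> x)) / h)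
      \<longlongrightarrow> (LINT x|lebesgue_on \<Omega>. d x * \<phi> x)) (at 0)"
    by (rule LIM_zero_cancel)
qed

text \<open>
  The derivative \<open>r \<mapsto> 2 max r 0\<close> of \<open>r \<mapsto> (max r 0)\<^sup>2\<close> is Lipschitz with constant 2, so
  the first-order Taylor remainder is quadratic with constant 1.
\<close>

lemma pos_part_square_expansion:
  "\<bar>(max b 0)\<^sup>2 - (max a 0)\<^sup>2 - 2 * max a 0 * (b - a)\<bar> \<le> (b - a)\<^sup>2" for a b :: real
proof -
  consider "a \<ge> 0" "b \<ge> 0" | "a \<ge> 0" "b < 0" | "a < 0" "b \<ge> 0" | "a < 0" "b < 0" by linarith
  then show ?thesis
  proof cases
    case 1
    have "0 \<le> (b - a)\<^sup>2" by simp
    with 1 show ?thesis by (simp add: power2_eq_square algebra_simps abs_if)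
  next
    case 2
    have "a * b \<le> 0"
      using 2 by (intro mult_nonneg_nonpos) auto
    moreover have "(max b 0)\<^sup>2 - (max a 0)\<^sup>2 - 2 * max a 0 * (b - a) = a\<^sup>2 - 2 * (a * b)"
      using 2 by (simp add: power2_eq_square algebra_simps max_def)
    moreover have "(b - a)\<^sup>2 = b\<^sup>2 - 2 * (a * b) + a\<^sup>2"
      by (simp add: power2_eq_square algebra_simps)
    moreover have "0 \<le> a\<^sup>2" "0 \<le> b\<^sup>2"
      by simp_all
    ultimately show ?thesis
      by linarith
  next
    case 3
    have "a * b \<le> 0"
      using 3 by (intro mult_nonpos_nonneg) auto
    moreover have "(max b 0)\<^sup>2 - (max a 0)\<^sup>2 - 2 * max a 0 * (b - a) = b\<^sup>2"
      using 3 by (simp add: power2_eq_square algebra_simps max_def)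
    moreover have "(b - a)\<^sup>2 = b\<^sup>2 - 2 * (a * b) + a\<^sup>2"
      by (simp add: power2_eq_square algebra_simps)
    moreover have "0 \<le> a\<^sup>2" "0 \<le> b\<^sup>2"
      by simp_all
    ultimately show ?thesis
      by linarith
  next
    case 4
    then show ?thesis by simp
  qed
qed

lemma L2_pos_part: "w \<in> L2 \<Omega> \<Longrightarrow> (\<lambda>x. max (w x) 0) \<in> L2 \<Omega>"
  by (rule L2_dominated[where u = w and C = 1]) (auto simp: L2_def)

lemma pos_part_energy_expansion:
  assumes a: "a \<in> L2 \<Omega>" and b: "b \<in> L2 \<Omega>"
  shows "\<bar>(LINT x|lebesgue_on \<Omega>. (max (b x) 0)\<^sup>2) - (LINT x|lebesgue_on \<Omega>. (max (a x) 0)\<^sup>2)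
      - 2 * (LINT x|lebesgue_on \<Omega>. (b x - a x) * max (a x) 0)\<bar>
    \<le> (LINT x|lebesgue_on \<Omega>. (b x - a x)\<^sup>2)"
proof -
  note [simp] = L2_integrable_square[OF L2_pos_part[OF a]] L2_integrable_square[OF L2_pos_part[OF b]]
    L2_mult_integrable[OF L2_diff[OF b a] L2_pos_part[OF a]] L2_integrable_square[OF L2_diff[OF b a]]
  have "\<bar>LINT x|lebesgue_on \<Omega>. (max (b x) 0)\<^sup>2 - (max (a x) 0)\<^sup>2 - 2 * ((b x - a x) * max (a x) 0)\<bar>
      \<le> (LINT x|lebesgue_on \<Omega>. \<bar>(max (b x) 0)\<^sup>2 - (max (a x) 0)\<^sup>2 - 2 * ((b x - a x) * max (a x) 0)\<bar>)"
    by (rule integral_abs_bound)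
  also have "\<dots> \<le> (LINT x|lebesgue_on \<Omega>. (b x - a x)\<^sup>2)"
  proof (rule integral_mono)
    show "\<bar>(max (b x) 0)\<^sup>2 - (max (a x) 0)\<^sup>2 - 2 * ((b x - a x) * max (a x) 0)\<bar> \<le> (b x - a x)\<^sup>2" for x
      using pos_part_square_expansion[of "b x" "a x"] by (simp add: ac_simps)
  qed auto
  finally show ?thesis by simp
qed

text \<open>
  The energy method. By the expansion above, the energy \<open>\<integral>(w\<^sup>+)\<^sup>2\<close> is differentiable along a curve
  that is differentiable in \<open>L\<^sup>2\<close>, with derivative \<open>2 \<integral>w' w\<^sup>+\<close>. If this is nonpositive, the energy
  stays at its initial value 0. All comparisons with solutions of the heat equation go through this
  lemma.
\<close>

lemma pos_part_vanishes:
  assumes mem: "\<And>r. 0 \<le> r \<Longrightarrow> w r \<in> L2 \<Omega>"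
    and init: "AE x in lebesgue_on \<Omega>. w 0 x \<le> 0"
    and cont0: "((\<lambda>r. L2_normsq \<Omega> (\<lambda>x. w r x - w 0 x)) \<longlongrightarrow> 0) (at 0 within {0..})"
    and deriv: "\<And>t. 0 < t \<Longrightarrow> t < T \<Longrightarrow> L2_curve_deriv \<Omega> w (w' t) t"
    and memd: "\<And>t. 0 < t \<Longrightarrow> t < T \<Longrightarrow> w' t \<in> L2 \<Omega>"
    and sign: "\<And>t. 0 < t \<Longrightarrow> t < T \<Longrightarrow> (LINT x|lebesgue_on \<Omega>. w' t x * max (w t x) 0) \<le> 0"
    and t: "0 \<le> t" "t < T"
  shows "AE x in lebesgue_on \<Omega>. w t x \<le> 0"
proof -
  define g where "g t = (LINT x|lebesgue_on \<Omega>. (max (w t x) 0)\<^sup>2)" for t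
  have g0: "g 0 = 0"
    unfolding g_def by (rule integral_eq_zero_AE) (use init in \<open>auto elim!: eventually_mono\<close>)
  have g_deriv: "(g has_real_derivative 2 * (LINT x|lebesgue_on \<Omega>. w' t x * max (w t x) 0)) (at t)"
    if t: "0 < t" "t < T" for t
  proof -
    have mt: "w t \<in> L2 \<Omega>" and dt: "w' t \<in> L2 \<Omega>" using t mem memd by auto
    have quot: "(\<lambda>x. (w (t + h) x - w t x) / h - w' t x) \<in> L2 \<Omega>" if "0 < t + h" for h
      using L2_diff[OF L2_add_scaled[OF mem mt, of "t+h" "1/h" "-1/h"] dt] that
      by (simp add: diff_divide_distrib)
    have lin: "((\<lambda>r. LINT x|lebesgue_on \<Omega>. w r x * max (w t x) 0) has_real_derivative
            (LINT x|lebesgue_on \<Omega>. w' t x * max (w t x) 0)) (at t)"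
      by (rule curve_product_deriv[OF mem dt L2_pos_part[OF mt] t(1) deriv[OF t]]) auto
    have sq: "((\<lambda>h. LINT x|lebesgue_on \<Omega>. ((w (t + h) x - w t x) / h - w' t x)\<^sup>2) \<longlongrightarrow> 0) (at 0)"
      using deriv[OF t] eventually_mono[OF eventually_add_pos[OF t(1)] quot]
      by (intro tendsto_L2_square) (auto simp: L2_curve_deriv_def)
    \<comment> \<open>The remainder is quadratic in \<open>h\<close>, so it does not contribute to the derivative.\<close>
    have rem: "\<bar>(g (t + h) - g t) / h
          - 2 * (((LINT x|lebesgue_on \<Omega>. w (t + h) x * max (w t x) 0) -
                 (LINT x|lebesgue_on \<Omega>. w t x * max (w t x) 0)) / h)\<bar>
        \<le> \<bar>h\<bar> * (2 * (LINT x|lebesgue_on \<Omega>. ((w (t + h) x - w t x) / h - w' t x)\<^sup>2)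
              + 2 * (LINT x|lebesgue_on \<Omega>. (w' t x)\<^sup>2))"
      if h: "0 < t + h" "h \<noteq> 0" for h
    proof -
      have mh: "w (t + h) \<in> L2 \<Omega>" using h mem by auto
      \<comment> \<open>\<open>w(t + h) - w(t) = h (D + w')\<close> with \<open>D \<rightarrow> 0\<close> in \<open>L\<^sup>2\<close>.\<close>
      let ?D = "\<lambda>x. (w (t + h) x - w t x) / h - w' t x"
      have "(LINT x|lebesgue_on \<Omega>. (w (t + h) x - w t x)\<^sup>2)
          \<le> (LINT x|lebesgue_on \<Omega>. h\<^sup>2 * (2 * (?D x)\<^sup>2 + 2 * (w' t x)\<^sup>2))"
      proof (rule integral_mono)
        fix x
        have "w (t + h) x - w t x = h * (?D x + w' t x)" using h by (simp add: field_simps)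
        then have "(w (t + h) x - w t x)\<^sup>2 = h\<^sup>2 * (?D x + w' t x)\<^sup>2"
          by (metis power_mult_distrib)
        also have "(?D x + w' t x)\<^sup>2 \<le> 2 * (?D x)\<^sup>2 + 2 * (w' t x)\<^sup>2"
          by (rule square_add_le)
        finally show "(w (t + h) x - w t x)\<^sup>2 \<le> h\<^sup>2 * (2 * (?D x)\<^sup>2 + 2 * (w' t x)\<^sup>2)"
          by (simp add: mult_left_mono)
      qed (use L2_integrable_square[OF L2_diff[OF mh mt]] L2_integrable_square[OF quot[OF h(1)]]
            L2_integrable_square[OF dt] in simp_all)
      also have "\<dots> = h\<^sup>2 * (2 * (LINT x|lebesgue_on \<Omega>. (?D x)\<^sup>2) + 2 * (LINT x|lebesgue_on \<Omega>. (w' t x)\<^sup>2))"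
        using L2_integrable_square[OF quot[OF h(1)]] L2_integrable_square[OF dt] by simp
      finally have bd: "(LINT x|lebesgue_on \<Omega>. (w (t + h) x - w t x)\<^sup>2) \<le> \<dots>" .
      have split: "(LINT x|lebesgue_on \<Omega>. (w (t + h) x - w t x) * max (w t x) 0) =
          (LINT x|lebesgue_on \<Omega>. w (t + h) x * max (w t x) 0) - (LINT x|lebesgue_on \<Omega>. w t x * max (w t x) 0)"
        using L2_mult_integrable[OF mh L2_pos_part[OF mt]] L2_mult_integrable[OF mt L2_pos_part[OF mt]]
        by (simp add: left_diff_distrib)
      have "\<bar>g (t + h) - g t - 2 * ((LINT x|lebesgue_on \<Omega>. w (t + h) x * max (w t x) 0) - (LINT x|lebesgue_on \<Omega>. w t x * max (w t x) 0))\<bar>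
         \<le> h\<^sup>2 * (2 * (LINT x|lebesgue_on \<Omega>. (?D x)\<^sup>2) + 2 * (LINT x|lebesgue_on \<Omega>. (w' t x)\<^sup>2))" (is "\<bar>?L\<bar> \<le> h\<^sup>2 * ?R")
        using pos_part_energy_expansion[OF mt mh] bd unfolding split g_def by linarith
      then have "\<bar>?L\<bar> / \<bar>h\<bar> \<le> h\<^sup>2 * ?R / \<bar>h\<bar>"
        by (rule divide_right_mono) simp
      moreover have "h\<^sup>2 / \<bar>h\<bar> = \<bar>h\<bar>"
        using h by (simp add: power2_eq_square abs_if)
      ultimately have "\<bar>?L / h\<bar> \<le> \<bar>h\<bar> * ?R"
        by (simp add: abs_divide times_divide_eq_left[symmetric] del: times_divide_eq_left)
      moreover have "?L / h = (g (t + h) - g t) / h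
          - 2 * (((LINT x|lebesgue_on \<Omega>. w (t + h) x * max (w t x) 0) -
                 (LINT x|lebesgue_on \<Omega>. w t x * max (w t x) 0)) / h)"
        by (simp add: diff_divide_distrib)
      ultimately show ?thesis by (simp only:)
    qed
    have "((\<lambda>h. (g (t + h) - g t) / h
          - 2 * (((LINT x|lebesgue_on \<Omega>. w (t + h) x * max (w t x) 0) -
                 (LINT x|lebesgue_on \<Omega>. w t x * max (w t x) 0)) / h)) \<longlongrightarrow> 0) (at 0)"
    proof (rule Lim_null_comparison)
      have "\<forall>\<^sub>F h in at 0. 0 < t + h \<and> h \<noteq> 0"
        using eventually_add_pos[OF t(1)] eventually_neq_at_within[of 0] by eventually_elim auto
      then show "\<forall>\<^sub>F h in at 0. norm ((g (t + h) - g t) / h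
          - 2 * (((LINT x|lebesgue_on \<Omega>. w (t + h) x * max (w t x) 0) -
                 (LINT x|lebesgue_on \<Omega>. w t x * max (w t x) 0)) / h))
         \<le> \<bar>h\<bar> * (2 * (LINT x|lebesgue_on \<Omega>. ((w (t + h) x - w t x) / h - w' t x)\<^sup>2)
              + 2 * (LINT x|lebesgue_on \<Omega>. (w' t x)\<^sup>2))"
        by eventually_elim (use rem in simp)
      have "((\<lambda>h. \<bar>h\<bar> * (2 * (LINT x|lebesgue_on \<Omega>. ((w (t + h) x - w t x) / h - w' t x)\<^sup>2)
              + 2 * (LINT x|lebesgue_on \<Omega>. (w' t x)\<^sup>2))) \<longlongrightarrow>
         \<bar>0\<bar> * (2 * 0 + 2 * (LINT x|lebesgue_on \<Omega>. (w' t x)\<^sup>2))) (at 0)"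
        by (intro tendsto_intros sq)
      then show "((\<lambda>h. \<bar>h\<bar> * (2 * (LINT x|lebesgue_on \<Omega>. ((w (t + h) x - w t x) / h - w' t x)\<^sup>2)
              + 2 * (LINT x|lebesgue_on \<Omega>. (w' t x)\<^sup>2))) \<longlongrightarrow> 0) (at 0)"
        by simp
    qed
    from tendsto_add[OF this tendsto_mult_left[OF lin[unfolded DERIV_def], of 2]]
    show ?thesis
      by (simp add: DERIV_def)
  qed
  have g_cont0: "(g \<longlongrightarrow> 0) (at 0 within {0..})"
  proof -
    have ev: "\<forall>\<^sub>F r in at 0 within {0..}. w r \<in> L2 \<Omega>"
      using mem by (auto simp: eventually_at_filter intro!: always_eventually)
    then have ev': "\<forall>\<^sub>F r in at 0 within {0..}. (\<lambda>x. w r x - w 0 x) \<in> L2 \<Omega>"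
      by eventually_elim (rule L2_diff, use mem in auto)
    have lim: "((\<lambda>r. (LINT x|lebesgue_on \<Omega>. (w r x - w 0 x)\<^sup>2)
         + 2 * \<bar>LINT x|lebesgue_on \<Omega>. (w r x - w 0 x) * max (w 0 x) 0\<bar>) \<longlongrightarrow> 0 + 2 * \<bar>0\<bar>) (at 0 within {0..})"
      by (intro tendsto_intros tendsto_L2_square tendsto_L2_product cont0 ev' L2_pos_part mem) auto
    show ?thesis
    proof (rule Lim_null_comparison)
      show "\<forall>\<^sub>F r in at 0 within {0..}. norm (g r) \<le> (LINT x|lebesgue_on \<Omega>. (w r x - w 0 x)\<^sup>2)
         + 2 * \<bar>LINT x|lebesgue_on \<Omega>. (w r x - w 0 x) * max (w 0 x) 0\<bar>"
        using ev
      proof eventually_elim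
        case (elim r)
        show ?case
          using pos_part_energy_expansion[OF mem[of 0] elim] g0 unfolding g_def real_norm_def by linarith
      qed
    qed (use lim in simp)
  qed
  have "g t \<le> g 0"
  proof (rule DERIV_nonpos_imp_decreasing_open[where f = g])
    show "\<exists>y. DERIV g x :> y \<and> y \<le> 0" if "0 < x" "x < t" for x
      using g_deriv[of x] sign[of x] that t
      by (intro exI[of _ "2 * (LINT y|lebesgue_on \<Omega>. w' x y * max (w x y) 0)"]) simp
    show "continuous_on {0..t} g"
      unfolding continuous_on_def
    proof
      fix r assume r: "r \<in> {0..t}"
      show "(g \<longlongrightarrow> g r) (at r within {0..t})"
      proof (cases "r = 0")
        case True
        then show ?thesis
          using tendsto_within_subset[OF g_cont0, of "{0..t}"] g0 by auto
      next
        case False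
        then have "isCont g r"
          using g_deriv[of r] r t by (intro DERIV_isCont) auto
        then show ?thesis
          by (simp add: isCont_def tendsto_within_subset[of _ _ _ UNIV])
      qed
    qed
  qed (use t in auto)
  then have "g t = 0"
    using g0 by (simp add: g_def antisym)
  then have "AE x in lebesgue_on \<Omega>. (max (w t x) 0)\<^sup>2 = 0"
    unfolding g_def by (subst integral_nonneg_eq_0_iff_AE[symmetric])
      (use L2_integrable_square[OF L2_pos_part[OF mem[OF t(1)]]] in auto)
  then show ?thesis
    by eventually_elim (simp add: max_def split: if_splits)
qed

section \<open>The energy form\<close>

interpretation lebesgue: sigma_finite_measure "lebesgue :: 'a::euclidean_space measure"
  by (rule sigma_finite_lebesgue)

interpretation lebesgue_pair:
  pair_sigma_finite "lebesgue :: 'a::euclidean_space measure" "lebesgue :: 'a measure"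
  by unfold_locales

abbreviation lebesgue2 :: "('a::euclidean_space \<times> 'a) measure" where
  "lebesgue2 \<equiv> lebesgue \<Otimes>\<^sub>M lebesgue"

definition jump :: "('a \<Rightarrow> real) \<Rightarrow> 'a \<times> 'a \<Rightarrow> real" where
  "jump u p = u (fst p) - u (snd p)"

definition weight :: "real \<Rightarrow> 'a::euclidean_space set \<Rightarrow> 'a \<times> 'a \<Rightarrow> real" where
  "weight s \<Omega> p = indicat_real (Q_set \<Omega>) p * frac_kernel s (fst p) (snd p)"

lemma E_form_eq:
  fixes \<Omega> :: "'a::euclidean_space set"
  shows "E_form s \<Omega> u v =
    frac_const DIM('a) s / 2 * (LINT p|lebesgue2. jump u p * jump v p * weight s \<Omega> p)"
  unfolding E_form_def set_lebesgue_integral_def jump_def weight_def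
  by (simp add: ac_simps)

lemma weight_nonneg: "0 \<le> weight s \<Omega> p"
  by (simp add: weight_def frac_kernel_def)

lemma measurable_jump [measurable]:
  "u \<in> borel_measurable lebesgue \<Longrightarrow> jump u \<in> borel_measurable lebesgue2"
  unfolding jump_def[abs_def]
  using measurable_compose[OF measurable_fst[of lebesgue lebesgue], of u borel]
    measurable_compose[OF measurable_snd[of lebesgue lebesgue], of u borel]
  by (intro borel_measurable_diff) simp_all

lemma measurable_weight:
  assumes [measurable]: "\<Omega> \<in> sets lebesgue"
  shows "weight s \<Omega> \<in> borel_measurable lebesgue2"
proof -
  have [measurable]: "(\<lambda>x. x) \<in> borel_measurable (lebesgue :: 'a measure)"
    by (auto intro: borel_measurable_if_lebesgue_on simp: measurable_def)
  have fs [measurable]: "fst \<in> borel_measurable (lebesgue2 :: ('a \<times> 'a) measure)"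
    "snd \<in> borel_measurable (lebesgue2 :: ('a \<times> 'a) measure)"
    using measurable_compose[OF measurable_fst[of lebesgue lebesgue], of "\<lambda>x. x" borel]
      measurable_compose[OF measurable_snd[of lebesgue lebesgue], of "\<lambda>x. x" borel] by simp_all
  have [measurable]: "Q_set \<Omega> \<in> sets lebesgue2"
    unfolding Q_set_def
    by (intro sets.Diff pair_measureI) (use sets.top[of "lebesgue2 :: ('a \<times> 'a) measure"]
        in \<open>auto simp: space_pair_measure\<close>)
  show ?thesis
    unfolding weight_def[abs_def] frac_kernel_def by measurable
qed

lemma AE_pair_fst_snd:
  assumes "AE x in (lebesgue :: 'a::euclidean_space measure). P x"
  shows "AE p in lebesgue2. P (fst p)" "AE p in lebesgue2. P (snd p)"
proof -
  obtain N where N: "N \<in> null_sets (lebesgue :: 'a measure)" "{x. \<not> P x} \<subseteq> N"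
    using assms by (auto simp: eventually_ae_filter)
  have "N \<times> UNIV \<in> null_sets (lebesgue2 :: ('a \<times> 'a) measure)"
    "UNIV \<times> N \<in> null_sets (lebesgue2 :: ('a \<times> 'a) measure)"
    using N(1) sets.top[of "lebesgue :: 'a measure"]
    by (auto simp: null_sets_def lebesgue.emeasure_pair_measure_Times)
  moreover have "{p \<in> space lebesgue2. \<not> P (fst p)} \<subseteq> N \<times> UNIV"
    "{p \<in> space lebesgue2. \<not> P (snd p)} \<subseteq> UNIV \<times> N"
    using N(2) by auto
  ultimately show "AE p in lebesgue2. P (fst p)" "AE p in lebesgue2. P (snd p)"
    by (blast intro: AE_I')+
qed

text \<open>
  Kernel bounds compare the energy with functions of the form \<open>f(x) g(y)\<close>.
\<close>

lemma integral_product: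
  fixes f g :: "'a::euclidean_space \<Rightarrow> real"
  assumes f: "integrable lebesgue f" and g: "integrable lebesgue g"
  shows "integrable lebesgue2 (\<lambda>p. f (fst p) * g (snd p))"
    and "(LINT p|lebesgue2. f (fst p) * g (snd p)) = (LINT x|lebesgue. f x) * (LINT y|lebesgue. g y)"
proof -
  have [measurable]: "f \<in> borel_measurable lebesgue" "g \<in> borel_measurable lebesgue"
    using f g by auto
  show int: "integrable lebesgue2 (\<lambda>p. f (fst p) * g (snd p))"
  proof (rule lebesgue_pair.Fubini_integrable)
    have "integrable lebesgue (\<lambda>x. \<bar>f x\<bar> * (LINT y|lebesgue. \<bar>g y\<bar>))"
      using f by auto
    then show "integrable lebesgue (\<lambda>x. LINT y|lebesgue. norm (f (fst (x, y)) * g (snd (x, y))))"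
      by (simp add: abs_mult)
  qed (use g in auto)
  have "(LINT x|lebesgue. (LINT y|lebesgue. f x * g y)) = (LINT p|lebesgue2. f (fst p) * g (snd p))"
    using lebesgue_pair.integral_fst'[OF int] by simp
  then show "(LINT p|lebesgue2. f (fst p) * g (snd p)) = (LINT x|lebesgue. f x) * (LINT y|lebesgue. g y)"
    by simp
qed

lemma frac_const_pos:
  assumes "0 < s" "s < 1"
  shows "0 < frac_const N s"
proof -
  have "- s \<notin> \<int>\<^sub>\<le>\<^sub>0"
  proof
    assume "- s \<in> \<int>\<^sub>\<le>\<^sub>0"
    then obtain n where "- s = of_int n" "n \<le> 0"
      by (auto elim!: nonpos_Ints_cases)
    with assms have "of_int n < (of_int 0 :: real)" "of_int (- 1) < (of_int n :: real)"
      by simp_all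
    then show False
      unfolding of_int_less_iff by linarith
  qed
  then have "\<bar>Gamma (- s)\<bar> > 0"
    by (simp add: Gamma_eq_zero_iff)
  moreover have "Gamma (real N / 2 + s) > 0"
    using assms by (intro Gamma_real_pos) (simp add: add_nonneg_pos)
  ultimately show ?thesis
    unfolding frac_const_def by (intro divide_pos_pos mult_pos_pos) auto
qed

text \<open>
  Everything needed to know about the geometry: a piece \<open>S\<close> of \<open>\<Sigma>\<^sub>1\<close> of finite positive measure to
  which all points of \<open>\<Omega>\<close> jump at a rate bounded below, as they do to each other. On the diagonal
  \<open>frac_kernel\<close> vanishes, so the bound has to exclude it.
\<close>

locale mixed_domain =
  fixes s :: real and \<Omega> \<Sigma>1 S :: "'a::euclidean_space set" and \<kappa> :: real
  assumes s: "0 < s" "s < 1"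
    and \<Omega>: "\<Omega> \<in> lmeasurable" "0 < measure lebesgue \<Omega>"
    and S: "S \<in> lmeasurable" "0 < measure lebesgue S" "S \<subseteq> \<Sigma>1" "\<Omega> \<inter> S = {}"
    and \<kappa>: "0 < \<kappa>"
    and kernel_ge: "\<And>x y. x \<in> \<Omega> \<Longrightarrow> y \<in> \<Omega> \<union> S \<Longrightarrow> x \<noteq> y \<Longrightarrow> \<kappa> \<le> frac_kernel s x y"
begin

abbreviation "E \<equiv> E_space s \<Omega> \<Sigma>1"
abbreviation "form \<equiv> E_form s \<Omega>"
abbreviation "w \<equiv> weight s \<Omega>"
abbreviation "int\<Omega> f \<equiv> LINT x|lebesgue_on \<Omega>. f x"

text \<open>
  The factor with which a bound of the kernel below by \<open>\<kappa>\<close> enters the form.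
\<close>

definition \<beta> :: real where "\<beta> = frac_const DIM('a) s / 2 * \<kappa>"

lemma \<beta>_pos: "0 < \<beta>"
  using frac_const_pos[OF s] \<kappa> by (simp add: \<beta>_def)

lemma \<Omega>_sets [measurable]: "\<Omega> \<in> sets lebesgue"
  using \<Omega> by (simp add: fmeasurable_def)

lemmas w_measurable [measurable] = measurable_weight[OF \<Omega>_sets, of s]

lemma measurable_on_\<Omega>: "u \<in> borel_measurable lebesgue \<Longrightarrow> u \<in> borel_measurable (lebesgue_on \<Omega>)"
  by (rule measurable_restrict_space1)

lemma integral_on_\<Omega>: "int\<Omega> f = (LINT x|lebesgue. indicator \<Omega> x * f x)" for f :: "'a \<Rightarrow> real"
  by (simp add: integral_restrict_space)

lemma integrable_on_\<Omega>:
  "integrable (lebesgue_on \<Omega>) f \<longleftrightarrow> integrable lebesgue (\<lambda>x. indicator \<Omega> x * f x)" for f :: "'a \<Rightarrow> real"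
  by (simp add: integrable_restrict_space)

lemma AE_on_\<Omega>: "(AE x in lebesgue_on \<Omega>. P x) \<longleftrightarrow> (AE x in lebesgue. x \<in> \<Omega> \<longrightarrow> P x)"
  by (simp add: AE_restrict_space_iff)

lemma AE_on_\<Omega>I: "AE x in lebesgue. P x \<Longrightarrow> AE x in lebesgue_on \<Omega>. P x"
  unfolding AE_on_\<Omega> by (auto elim: eventually_mono)

lemma one_L2: "(\<lambda>x. 1) \<in> L2 \<Omega>"
  using \<Omega> by (auto simp: L2_def integrable_on_\<Omega> fmeasurable_def less_top)

lemma L2_integrable: "u \<in> L2 \<Omega> \<Longrightarrow> integrable (lebesgue_on \<Omega>) u"
  using L2_mult_integrable[OF _ one_L2] by simp

lemma in_E_iff:
  "u \<in> E \<longleftrightarrow> u \<in> borel_measurable lebesgue \<and> (AE x in lebesgue. x \<in> \<Sigma>1 \<longrightarrow> u x = 0) \<and>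
     integrable (lebesgue_on \<Omega>) (\<lambda>x. (u x)\<^sup>2) \<and> integrable lebesgue2 (\<lambda>p. (jump u p)\<^sup>2 * w p)"
proof (cases "u \<in> borel_measurable lebesgue")
  case True
  note [measurable] = True
  have "(\<integral>\<^sup>+p\<in>Q_set \<Omega>. ennreal ((u (fst p) - u (snd p))\<^sup>2 * frac_kernel s (fst p) (snd p)) \<partial>lebesgue2)
      = (\<integral>\<^sup>+p. ennreal ((jump u p)\<^sup>2 * w p) \<partial>lebesgue2)"
    by (rule nn_integral_cong) (simp add: jump_def weight_def indicator_def)
  moreover have "integrable lebesgue2 (\<lambda>p. (jump u p)\<^sup>2 * w p) \<longleftrightarrow>
      (\<integral>\<^sup>+p. ennreal ((jump u p)\<^sup>2 * w p) \<partial>lebesgue2) < \<infinity>"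
    by (simp add: integrable_iff_bounded weight_nonneg)
  moreover have "integrable (lebesgue_on \<Omega>) (\<lambda>x. (u x)\<^sup>2) \<longleftrightarrow>
      (\<integral>\<^sup>+x. ennreal ((u x)\<^sup>2) \<partial>lebesgue_on \<Omega>) < \<infinity>"
    using measurable_on_\<Omega>[OF True] by (simp add: integrable_iff_bounded)
  ultimately show ?thesis
    by (auto simp: E_space_def E_normsq_def L2_normsq_def)
qed (auto simp: E_space_def)

lemma E_measurable: "u \<in> E \<Longrightarrow> u \<in> borel_measurable lebesgue"
  and E_zero: "u \<in> E \<Longrightarrow> AE x in lebesgue. x \<in> \<Sigma>1 \<longrightarrow> u x = 0"
  and E_jump_square: "u \<in> E \<Longrightarrow> integrable lebesgue2 (\<lambda>p. (jump u p)\<^sup>2 * w p)"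
  by (auto simp: in_E_iff)

lemma E_L2: "u \<in> E \<Longrightarrow> u \<in> L2 \<Omega>"
  by (auto simp: in_E_iff L2_def measurable_on_\<Omega>)

lemma E_jump_product:
  assumes "u \<in> E" "v \<in> E"
  shows "integrable lebesgue2 (\<lambda>p. jump u p * jump v p * w p)"
proof (rule Bochner_Integration.integrable_bound)
  note [measurable] = assms[THEN E_measurable]
  show "integrable lebesgue2 (\<lambda>p. (jump u p)\<^sup>2 * w p + (jump v p)\<^sup>2 * w p)"
    using assms by (intro Bochner_Integration.integrable_add E_jump_square)
  show "(\<lambda>p. jump u p * jump v p * w p) \<in> borel_measurable lebesgue2"
    by measurable
  show "AE p in lebesgue2. norm (jump u p * jump v p * w p)
      \<le> norm ((jump u p)\<^sup>2 * w p + (jump v p)\<^sup>2 * w p)"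
  proof (rule AE_I2)
    fix p
    have "\<bar>jump u p * jump v p\<bar> * w p \<le> ((jump u p)\<^sup>2 + (jump v p)\<^sup>2) * w p"
      by (intro mult_right_mono abs_mult_le weight_nonneg)
    then show "norm (jump u p * jump v p * w p) \<le> norm ((jump u p)\<^sup>2 * w p + (jump v p)\<^sup>2 * w p)"
      using weight_nonneg[of s \<Omega> p] by (simp add: abs_mult distrib_right)
  qed
qed

text \<open>
  All functions that are tested with below belong to the energy space because their values and
  increments are controlled by those of one or two known members. In particular they inherit the zeros
  on \<open>\<Sigma>\<^sub>1\<close>.
\<close>

lemma E_dominated:
  assumes v [measurable]: "v \<in> borel_measurable lebesgue" and u1: "u1 \<in> E" and u2: "u2 \<in> E"
    and dom: "AE x in lebesgue. \<bar>v x\<bar> \<le> a * \<bar>u1 x\<bar> + b * \<bar>u2 x\<bar>"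
    and dom_jump: "AE p in lebesgue2. \<bar>jump v p\<bar> \<le> a * \<bar>jump u1 p\<bar> + b * \<bar>jump u2 p\<bar>"
  shows "v \<in> E"
proof -
  have sq: "t\<^sup>2 \<le> 2 * a\<^sup>2 * p\<^sup>2 + 2 * b\<^sup>2 * q\<^sup>2" if "\<bar>t\<bar> \<le> a * \<bar>p\<bar> + b * \<bar>q\<bar>" for t p q :: real
  proof -
    have "\<bar>t\<bar>\<^sup>2 \<le> (a * \<bar>p\<bar> + b * \<bar>q\<bar>)\<^sup>2"
      using that by (intro power_mono) auto
    also have "\<dots> \<le> 2 * (a * \<bar>p\<bar>)\<^sup>2 + 2 * (b * \<bar>q\<bar>)\<^sup>2"
      by (rule square_add_le)
    finally show ?thesis
      by (simp add: power_mult_distrib)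
  qed
  have "AE x in lebesgue. x \<in> \<Sigma>1 \<longrightarrow> v x = 0"
    using dom E_zero[OF u1] E_zero[OF u2] by eventually_elim auto
  moreover have "integrable (lebesgue_on \<Omega>) (\<lambda>x. (v x)\<^sup>2)"
  proof (rule Bochner_Integration.integrable_bound)
    show "integrable (lebesgue_on \<Omega>) (\<lambda>x. 2 * a\<^sup>2 * (u1 x)\<^sup>2 + 2 * b\<^sup>2 * (u2 x)\<^sup>2)"
      using E_L2[OF u1] E_L2[OF u2] by (auto simp: L2_def)
    show "AE x in lebesgue_on \<Omega>. norm ((v x)\<^sup>2) \<le> norm (2 * a\<^sup>2 * (u1 x)\<^sup>2 + 2 * b\<^sup>2 * (u2 x)\<^sup>2)"
      using AE_on_\<Omega>I[OF dom] by eventually_elim (use sq in auto)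
  qed (use measurable_on_\<Omega>[OF v] in measurable)
  moreover have "integrable lebesgue2 (\<lambda>p. (jump v p)\<^sup>2 * w p)"
  proof (rule Bochner_Integration.integrable_bound)
    show "integrable lebesgue2 (\<lambda>p. 2 * a\<^sup>2 * ((jump u1 p)\<^sup>2 * w p) + 2 * b\<^sup>2 * ((jump u2 p)\<^sup>2 * w p))"
      using E_jump_square[OF u1] E_jump_square[OF u2] by auto
    show "AE p in lebesgue2. norm ((jump v p)\<^sup>2 * w p)
        \<le> norm (2 * a\<^sup>2 * ((jump u1 p)\<^sup>2 * w p) + 2 * b\<^sup>2 * ((jump u2 p)\<^sup>2 * w p))"
      using dom_jump
    proof eventually_elim
      case (elim p)
      from mult_right_mono[OF sq[OF elim] weight_nonneg[of s \<Omega> p]] show ?case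
        using weight_nonneg[of s \<Omega> p] by (simp add: algebra_simps)
    qed
  qed measurable
  ultimately show ?thesis
    by (simp add: in_E_iff)
qed

lemma E_add_scaled:
  assumes "u \<in> E" "v \<in> E"
  shows "(\<lambda>x. a * u x + b * v x) \<in> E"
proof (rule E_dominated[OF _ assms])
  note [measurable] = assms[THEN E_measurable]
  show "(\<lambda>x. a * u x + b * v x) \<in> borel_measurable lebesgue" by measurable
  have tri: "\<bar>a * p + b * q\<bar> \<le> \<bar>a\<bar> * \<bar>p\<bar> + \<bar>b\<bar> * \<bar>q\<bar>" for p q :: real
    by (metis abs_mult abs_triangle_ineq)
  show "AE x in lebesgue. \<bar>a * u x + b * v x\<bar> \<le> \<bar>a\<bar> * \<bar>u x\<bar> + \<bar>b\<bar> * \<bar>v x\<bar>"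
    using tri by auto
  have "jump (\<lambda>x. a * u x + b * v x) p = a * jump u p + b * jump v p" for p
    by (simp add: jump_def algebra_simps)
  then show "AE p in lebesgue2. \<bar>jump (\<lambda>x. a * u x + b * v x) p\<bar> \<le> \<bar>a\<bar> * \<bar>jump u p\<bar> + \<bar>b\<bar> * \<bar>jump v p\<bar>"
    using tri by auto
qed

lemma E_diff: "u \<in> E \<Longrightarrow> v \<in> E \<Longrightarrow> (\<lambda>x. u x - v x) \<in> E"
  using E_add_scaled[of u v 1 "-1"] by simp

lemma E_uminus: "u \<in> E \<Longrightarrow> (\<lambda>x. - u x) \<in> E"
  using E_add_scaled[of u u "-1" 0] by simp

lemma E_contraction:
  assumes u: "u \<in> E" and F [measurable]: "F \<in> borel_measurable borel" and "F 0 = 0"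
    and lip: "\<And>p q. \<bar>F p - F q\<bar> \<le> \<bar>p - q\<bar>"
  shows "(\<lambda>x. F (u x)) \<in> E"
proof (rule E_dominated[OF _ u u])
  note [measurable] = E_measurable[OF u]
  show "(\<lambda>x. F (u x)) \<in> borel_measurable lebesgue" by measurable
  show "AE x in lebesgue. \<bar>F (u x)\<bar> \<le> 1 * \<bar>u x\<bar> + 0 * \<bar>u x\<bar>"
    using lip[of _ 0] \<open>F 0 = 0\<close> by auto
  show "AE p in lebesgue2. \<bar>jump (\<lambda>x. F (u x)) p\<bar> \<le> 1 * \<bar>jump u p\<bar> + 0 * \<bar>jump u p\<bar>"
    using lip by (auto simp: jump_def)
qed

lemma E_pos_part: "u \<in> E \<Longrightarrow> (\<lambda>x. max (u x) 0) \<in> E"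
  by (rule E_contraction[of u "\<lambda>r. max r 0"]) auto

lemma E_mult_bounded:
  assumes u: "u \<in> E" and v: "v \<in> E"
    and "AE x in lebesgue. \<bar>u x\<bar> \<le> a" "AE x in lebesgue. \<bar>v x\<bar> \<le> b"
  shows "(\<lambda>x. u x * v x) \<in> E"
proof (rule E_dominated[OF _ u v])
  note [measurable] = E_measurable[OF u] E_measurable[OF v]
  show "(\<lambda>x. u x * v x) \<in> borel_measurable lebesgue" by measurable
  show "AE x in lebesgue. \<bar>u x * v x\<bar> \<le> b * \<bar>u x\<bar> + a * \<bar>v x\<bar>"
    using assms(3,4)
  proof eventually_elim
    case (elim x)
    have "\<bar>u x\<bar> * \<bar>v x\<bar> \<le> \<bar>u x\<bar> * b" "0 \<le> a * \<bar>v x\<bar>"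
      using elim by (auto intro!: mult_left_mono mult_nonneg_nonneg)
    then show ?case by (simp add: abs_mult mult.commute)
  qed
  show "AE p in lebesgue2. \<bar>jump (\<lambda>x. u x * v x) p\<bar> \<le> b * \<bar>jump u p\<bar> + a * \<bar>jump v p\<bar>"
    using AE_pair_fst_snd(1)[OF assms(3)] AE_pair_fst_snd(2)[OF assms(4)]
  proof eventually_elim
    case (elim p)
    have "jump (\<lambda>x. u x * v x) p = v (snd p) * jump u p + u (fst p) * jump v p"
      by (simp add: jump_def algebra_simps)
    also have "\<bar>\<dots>\<bar> \<le> \<bar>v (snd p)\<bar> * \<bar>jump u p\<bar> + \<bar>u (fst p)\<bar> * \<bar>jump v p\<bar>"
      by (metis abs_mult abs_triangle_ineq)
    also have "\<dots> \<le> b * \<bar>jump u p\<bar> + a * \<bar>jump v p\<bar>"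
      using elim by (intro add_mono mult_right_mono) auto
    finally show ?case .
  qed
qed

lemma form_commute: "form u v = form v u"
  by (simp add: E_form_eq mult.commute)

lemma form_add_scaled:
  assumes "u \<in> E" "v \<in> E" "\<phi> \<in> E"
  shows "form (\<lambda>x. a * u x + b * v x) \<phi> = a * form u \<phi> + b * form v \<phi>"
proof -
  have "(LINT p|lebesgue2. jump (\<lambda>x. a * u x + b * v x) p * jump \<phi> p * w p)
      = (LINT p|lebesgue2. a * (jump u p * jump \<phi> p * w p) + b * (jump v p * jump \<phi> p * w p))"
    by (rule Bochner_Integration.integral_cong) (auto simp: jump_def algebra_simps)
  then show ?thesis
    using E_jump_product[OF assms(1,3)] E_jump_product[OF assms(2,3)]
    by (simp add: E_form_eq algebra_simps)
qed

lemma form_uminus: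
  assumes "u \<in> E" "\<phi> \<in> E"
  shows "form (\<lambda>x. - u x) \<phi> = - form u \<phi>"
  using form_add_scaled[OF assms(1) assms, of "-1" 0] by simp

lemma form_mono:
  assumes "u \<in> E" "v \<in> E" "u' \<in> E" "v' \<in> E"
    and "\<And>p. jump u p * jump v p \<le> jump u' p * jump v' p"
  shows "form u v \<le> form u' v'"
  unfolding E_form_eq
  using frac_const_pos[OF s, of "DIM('a)"] assms weight_nonneg
  by (intro mult_left_mono integral_mono E_jump_product mult_right_mono) auto

text \<open>
  The first Beurling-Deny property: \<open>F(p) - F(q)\<close> has the sign of \<open>p - q\<close> and at most its modulus.
\<close>

lemma form_contraction:
  assumes u: "u \<in> E" and Fu: "(\<lambda>x. F (u x)) \<in> E" and F: "mono F" "\<And>p q. \<bar>F p - F q\<bar> \<le> \<bar>p - q\<bar>"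
  shows "form (\<lambda>x. F (u x)) (\<lambda>x. F (u x)) \<le> form u (\<lambda>x. F (u x))"
proof (rule form_mono[OF Fu Fu u Fu])
  fix p :: "'a \<times> 'a"
  have "(F a - F b) * (F a - F b) \<le> (a - b) * (F a - F b)" for a b :: real
  proof (cases "a \<le> b")
    case True
    then show ?thesis
      using monoD[OF F(1) True] F(2)[of a b] by (intro mult_right_mono_neg) auto
  next
    case False
    then have "b \<le> a" by simp
    then show ?thesis
      using monoD[OF F(1) \<open>b \<le> a\<close>] F(2)[of a b] by (intro mult_right_mono) auto
  qed
  then show "jump (\<lambda>x. F (u x)) p * jump (\<lambda>x. F (u x)) p \<le> jump u p * jump (\<lambda>x. F (u x)) p"
    by (simp add: jump_def)
qed

lemma integral_ge_product:
  assumes H: "integrable lebesgue2 H" and f: "integrable lebesgue f" and g: "integrable lebesgue g"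
    and le: "AE p in lebesgue2. \<kappa> * (f (fst p) * g (snd p)) \<le> H p"
  shows "\<beta> * (LINT x|lebesgue. f x) * (LINT y|lebesgue. g y)
    \<le> frac_const DIM('a) s / 2 * (LINT p|lebesgue2. H p)"
proof -
  have "\<kappa> * ((LINT x|lebesgue. f x) * (LINT y|lebesgue. g y)) = (LINT p|lebesgue2. \<kappa> * (f (fst p) * g (snd p)))"
    using integral_product(2)[OF f g] by simp
  also have "\<dots> \<le> (LINT p|lebesgue2. H p)"
    using integral_product(1)[OF f g] by (intro integral_mono_AE H le) auto
  finally show ?thesis
    using frac_const_pos[OF s, of "DIM('a)"]
    unfolding \<beta>_def by (simp add: mult.assoc mult_left_mono)
qed

lemma weight_ge:
  assumes "fst p \<in> \<Omega>" "snd p \<in> \<Omega> \<union> S" "fst p \<noteq> snd p"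
  shows "\<kappa> \<le> w p"
  using assms kernel_ge[of "fst p" "snd p"] by (auto simp: weight_def Q_set_def indicator_def)

lemma integrable_indicator_S: "integrable lebesgue (indicat_real S)"
  using S by (auto simp: fmeasurable_def)

text \<open>
  Since \<open>u\<close> vanishes on \<open>S\<close>, the increments between \<open>\<Omega>\<close> and \<open>S\<close> alone contribute at least
  \<open>\<beta> |S| \<integral>u F(u)\<close>, as a potential of that size would; by monotonicity no other pair contributes
  negatively.
\<close>

lemma form_killing:
  assumes u: "u \<in> E" and Fu: "(\<lambda>x. F (u x)) \<in> E" and F: "mono F" "F 0 = (0::real)"
  shows "\<beta> * measure lebesgue S * int\<Omega> (\<lambda>x. u x * F (u x)) \<le> form u (\<lambda>x. F (u x))"
proof -
  have "\<beta> * (LINT x|lebesgue. indicator \<Omega> x * (u x * F (u x))) * (LINT y|lebesgue. indicat_real S y)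
    \<le> form u (\<lambda>x. F (u x))"
    unfolding E_form_eq
  proof (rule integral_ge_product[OF E_jump_product[OF u Fu] _ integrable_indicator_S])
    show "integrable lebesgue (\<lambda>x. indicator \<Omega> x * (u x * F (u x)))"
      using L2_mult_integrable[OF E_L2[OF u] E_L2[OF Fu]] by (simp add: integrable_on_\<Omega>)
    have mono: "0 \<le> (a - b) * (F a - F b)" for a b
      using monoD[OF F(1), of a b] monoD[OF F(1), of b a]
      by (cases "a \<le> b") (auto intro!: mult_nonneg_nonneg mult_nonpos_nonpos)
    show "AE p in lebesgue2. \<kappa> * (indicator \<Omega> (fst p) * (u (fst p) * F (u (fst p))) * indicat_real S (snd p))
        \<le> jump u p * jump (\<lambda>x. F (u x)) p * w p"
      using AE_pair_fst_snd(2)[OF E_zero[OF u]]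
    proof eventually_elim
      case (elim p)
      show ?case
      proof (cases "fst p \<in> \<Omega> \<and> snd p \<in> S")
        case True
        then have "u (snd p) = 0" and "fst p \<noteq> snd p"
          using elim S by auto
        then have "jump u p * jump (\<lambda>x. F (u x)) p = u (fst p) * F (u (fst p))"
          by (simp add: jump_def F)
        moreover have "\<kappa> * (u (fst p) * F (u (fst p))) \<le> w p * (u (fst p) * F (u (fst p)))"
          using True \<open>fst p \<noteq> snd p\<close> mono[of "u (fst p)" 0] F(2)
          by (intro mult_right_mono weight_ge) auto
        ultimately show ?thesis
          using True by (simp add: mult.commute)
      next
        case False
        then have "indicator \<Omega> (fst p) * (u (fst p) * F (u (fst p))) * indicat_real S (snd p) = 0"
          by (auto simp: indicator_def)
        then show ?thesis
          using mono[of "u (fst p)" "u (snd p)"] weight_nonneg[of s \<Omega> p]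
          unfolding jump_def by (simp only: mult_zero_right mult_nonneg_nonneg)
      qed
    qed
  qed
  then show ?thesis
    using \<Omega>_sets by (simp add: integral_on_\<Omega> mult.commute mult.left_commute)
qed

lemma zero_on_\<Omega>:
  assumes "v \<in> E" "int\<Omega> (\<lambda>x. (v x)\<^sup>2) \<le> 0"
  shows "AE x in lebesgue_on \<Omega>. v x = 0"
proof -
  have "int\<Omega> (\<lambda>x. (v x)\<^sup>2) = 0"
    using assms(2) by (intro antisym) auto
  then have "AE x in lebesgue_on \<Omega>. (v x)\<^sup>2 = 0"
    by (subst (asm) integral_nonneg_eq_0_iff_AE) (use L2_integrable_square[OF E_L2[OF assms(1)]] in auto)
  then show ?thesis by simp
qed

text \<open>
  Killing forces \<open>v = 0\<close> on \<open>\<Omega>\<close>. Vanishing energy also makes \<open>v(x) = v(y)\<close> for almost all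
  \<open>x \<in> \<Omega>\<close> and \<open>y\<close>, which carries the zero to the whole space.
\<close>

lemma form_definite:
  assumes v: "v \<in> E" and "form v v \<le> 0"
  shows "AE x in lebesgue. v x = 0"
proof -
  have "\<beta> * measure lebesgue S * int\<Omega> (\<lambda>x. v x * v x) \<le> 0"
    using form_killing[of v "\<lambda>x. x"] assms by (auto simp: mono_def)
  then have "int\<Omega> (\<lambda>x. (v x)\<^sup>2) \<le> 0"
    using \<beta>_pos S(2) by (simp add: power2_eq_square mult_le_0_iff zero_le_mult_iff)
  then have zero\<Omega>: "AE x in lebesgue. x \<in> \<Omega> \<longrightarrow> v x = 0"
    using zero_on_\<Omega>[OF v] by (simp add: AE_on_\<Omega>)
  have "frac_const DIM('a) s * (LINT p|lebesgue2. (jump v p)\<^sup>2 * w p) \<le> 0"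
    using assms(2) by (simp add: E_form_eq power2_eq_square)
  then have "(LINT p|lebesgue2. (jump v p)\<^sup>2 * w p) = 0"
    using frac_const_pos[OF s, of "DIM('a)"]
    by (intro antisym) (auto simp: mult_le_0_iff weight_nonneg intro!: integral_nonneg_AE)
  then have "AE p in lebesgue2. (jump v p)\<^sup>2 * w p = 0"
    by (subst (asm) integral_nonneg_eq_0_iff_AE) (use E_jump_square[OF v] in \<open>auto simp: weight_nonneg\<close>)
  then have "AE p in lebesgue2. fst p \<in> \<Omega> \<longrightarrow> v (snd p) = 0"
    using AE_pair_fst_snd(1)[OF zero\<Omega>]
  proof eventually_elim
    case (elim p)
    show ?case
    proof
      assume p: "fst p \<in> \<Omega>"
      with elim have "v (fst p) = 0" by simp
      moreover have "jump v p = 0"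
      proof (cases "fst p = snd p")
        case True
        then show ?thesis by (simp add: jump_def)
      next
        case False
        then have "w p > 0"
          using p by (auto simp: weight_def frac_kernel_def Q_set_def indicator_def)
        with elim show ?thesis by simp
      qed
      ultimately show "v (snd p) = 0"
        by (simp add: jump_def)
    qed
  qed
  from lebesgue_pair.AE_pair[OF this]
  have ae: "AE x in lebesgue. AE y in lebesgue. x \<in> \<Omega> \<longrightarrow> v y = 0"
    by simp
  show ?thesis
  proof (rule ccontr)
    assume no: "\<not> (AE y in lebesgue. v y = 0)"
    from ae have "AE x in lebesgue. x \<notin> \<Omega>"
      by eventually_elim (use no in auto)
    then have "\<Omega> \<in> null_sets lebesgue"
      by (simp add: AE_iff_null_sets)
    then show False
      using \<Omega> by (auto simp: null_sets_def measure_def)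
  qed
qed

lemma pos_part_vanishes_of_form:
  assumes v: "v \<in> E" and "form v (\<lambda>x. max (v x) 0) \<le> 0"
  shows "AE x in lebesgue. v x \<le> 0"
proof -
  have "form (\<lambda>x. max (v x) 0) (\<lambda>x. max (v x) 0) \<le> form v (\<lambda>x. max (v x) 0)"
    by (rule form_contraction[OF v E_pos_part[OF v]]) (auto intro: monoI)
  then have "AE x in lebesgue. max (v x) 0 = 0"
    using assms by (intro form_definite E_pos_part) auto
  then show ?thesis
    by eventually_elim simp
qed

text \<open>
  Pointwise \<open>(a - b) (a\<^sup>+ - b\<^sup>+) \<ge> a\<^sup>- b\<^sup>+\<close>, and on \<open>\<Omega> \<times> \<Omega>\<close> the kernel is bounded below, so the
  double integral is at least a product of two integrals. This is where jumps inside \<open>\<Omega>\<close> act like a source term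
  of the size of the total mass.
\<close>

lemma form_pos_part_ge:
  assumes v: "v \<in> E"
  shows "\<beta> * int\<Omega> (\<lambda>x. max (- v x) 0) * int\<Omega> (\<lambda>x. max (v x) 0) \<le> form v (\<lambda>x. max (v x) 0)"
  unfolding E_form_eq integral_on_\<Omega>
proof (rule integral_ge_product[OF E_jump_product[OF v E_pos_part[OF v]]])
  show "integrable lebesgue (\<lambda>x. indicator \<Omega> x * max (- v x) 0)"
    "integrable lebesgue (\<lambda>x. indicator \<Omega> x * max (v x) 0)"
    using L2_integrable[OF E_L2[OF E_pos_part[OF v]]]
      L2_integrable[OF E_L2[OF E_pos_part[OF E_uminus[OF v]]]] by (simp_all add: integrable_on_\<Omega>)
  show "AE p in lebesgue2. \<kappa> * (indicator \<Omega> (fst p) * max (- v (fst p)) 0 * (indicator \<Omega> (snd p) * max (v (snd p)) 0))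
     \<le> jump v p * jump (\<lambda>x. max (v x) 0) p * w p"
  proof (rule AE_I2)
    fix p :: "'a \<times> 'a"
    have key: "0 \<le> max (- a) 0 * max b 0" "max (- a) 0 * max b 0 \<le> (a - b) * (max a 0 - max b 0)"
      for a b :: real
    proof -
      show "0 \<le> max (- a) 0 * max b 0" by simp
      show "max (- a) 0 * max b 0 \<le> (a - b) * (max a 0 - max b 0)"
      proof -
        have "0 \<le> (a - b) * (max a 0 - max b 0)"
          using mult_nonneg_nonneg[of "a - b" "max a 0 - max b 0"]
            mult_nonpos_nonpos[of "a - b" "max a 0 - max b 0"] by (cases "a \<le> b") auto
        moreover have "max (- a) 0 * max b 0 = 0" if "0 \<le> a \<or> b \<le> 0"
          using that by (auto simp: max_def)
        moreover have "(- a) * b \<le> (a - b) * (0 - b)"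
          by (simp add: left_diff_distrib)
        moreover have "max (- a) 0 = - a" "max b 0 = b" "max a 0 = 0" if "\<not> (0 \<le> a \<or> b \<le> 0)"
          using that by simp_all
        ultimately show ?thesis
          by metis
      qed
    qed
    show "\<kappa> * (indicator \<Omega> (fst p) * max (- v (fst p)) 0 * (indicator \<Omega> (snd p) * max (v (snd p)) 0))
     \<le> jump v p * jump (\<lambda>x. max (v x) 0) p * w p"
    proof (cases "fst p \<in> \<Omega> \<and> snd p \<in> \<Omega> \<and> fst p \<noteq> snd p")
      case True
      then have "\<kappa> * (max (- v (fst p)) 0 * max (v (snd p)) 0)
        \<le> w p * ((v (fst p) - v (snd p)) * (max (v (fst p)) 0 - max (v (snd p)) 0))"
        by (intro mult_mono[OF weight_ge key(2) weight_nonneg key(1)]) auto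
      with True show ?thesis
        by (simp add: jump_def ac_simps)
    next
      case False
      then have "indicator \<Omega> (fst p) * max (- v (fst p)) 0 * (indicator \<Omega> (snd p) * max (v (snd p)) 0) = 0"
        by (auto simp: indicator_def max_def)
      then show ?thesis
        using order_trans[OF key, of "v (fst p)" "v (snd p)"] weight_nonneg[of s \<Omega> p]
        unfolding jump_def by (simp only: mult_zero_right mult_nonneg_nonneg)
    qed
  qed
qed

section \<open>The elliptic solution\<close>

lemma elliptic_nonneg:
  assumes "elliptic_solution s \<Omega> \<Sigma>1 \<xi>"
  shows "AE x in lebesgue. 0 \<le> \<xi> x"
proof -
  have \<xi>: "\<xi> \<in> E" and v: "(\<lambda>x. max (- \<xi> x) 0) \<in> E"
    using assms E_pos_part[OF E_uminus] by (auto simp: elliptic_solution_def)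
  have "form (\<lambda>x. - \<xi> x) (\<lambda>x. max (- \<xi> x) 0) = - int\<Omega> (\<lambda>x. max (- \<xi> x) 0)"
    using assms form_uminus[OF \<xi> v] v by (simp add: elliptic_solution_def)
  also have "\<dots> \<le> 0"
    by simp
  finally have "AE x in lebesgue. - \<xi> x \<le> 0"
    by (rule pos_part_vanishes_of_form[OF E_uminus[OF \<xi>]])
  then show ?thesis by simp
qed

text \<open>
  The reciprocal of the killing rate; it bounds the elliptic solution.
\<close>

definition C :: real where "C = 1 / (\<beta> * measure lebesgue S)"

lemma C_pos: "0 < C"
  using \<beta>_pos S by (simp add: C_def)

text \<open>
  With \<open>v = (\<xi> - C)\<^sup>+\<close>, the killing estimate and the equation give \<open>\<integral>\<xi> v \<le> C \<integral>v\<close>. But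
  \<open>\<xi> v - C v = v\<^sup>2\<close>, so \<open>v = 0\<close> on \<open>\<Omega>\<close>; then \<open>\<E>(v, v) \<le> \<integral>v = 0\<close> gives \<open>v = 0\<close> everywhere. The
  bound outside \<open>\<Omega>\<close> is what puts products with \<open>\<xi>\<close> into the energy space.
\<close>

lemma elliptic_bounded:
  assumes "elliptic_solution s \<Omega> \<Sigma>1 \<xi>"
  shows "AE x in lebesgue. \<xi> x \<le> C"
proof -
  let ?F = "\<lambda>r. max (r - C) 0"
  have \<xi>: "\<xi> \<in> E"
    using assms by (simp add: elliptic_solution_def)
  have v: "(\<lambda>x. ?F (\<xi> x)) \<in> E"
    by (rule E_contraction[OF \<xi>, of ?F]) (use C_pos in auto)
  have eq: "form \<xi> (\<lambda>x. ?F (\<xi> x)) = int\<Omega> (\<lambda>x. ?F (\<xi> x))"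
    using assms v by (simp add: elliptic_solution_def)
  have "\<beta> * measure lebesgue S * int\<Omega> (\<lambda>x. \<xi> x * ?F (\<xi> x)) \<le> int\<Omega> (\<lambda>x. ?F (\<xi> x))"
    unfolding eq[symmetric] by (rule form_killing[OF \<xi> v]) (use C_pos in \<open>auto intro: monoI\<close>)
  then have le: "int\<Omega> (\<lambda>x. \<xi> x * ?F (\<xi> x)) \<le> C * int\<Omega> (\<lambda>x. ?F (\<xi> x))"
    using \<beta>_pos S(2) by (simp add: C_def field_simps)
  have "int\<Omega> (\<lambda>x. (?F (\<xi> x))\<^sup>2) = int\<Omega> (\<lambda>x. \<xi> x * ?F (\<xi> x) - C * ?F (\<xi> x))"
    by (rule Bochner_Integration.integral_cong) (auto simp: max_def power2_eq_square algebra_simps)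
  also have "\<dots> = int\<Omega> (\<lambda>x. \<xi> x * ?F (\<xi> x)) - C * int\<Omega> (\<lambda>x. ?F (\<xi> x))"
    using L2_mult_integrable[OF E_L2[OF \<xi>] E_L2[OF v]] L2_integrable[OF E_L2[OF v]] by simp
  finally have "AE x in lebesgue_on \<Omega>. ?F (\<xi> x) = 0"
    using le by (intro zero_on_\<Omega>[OF v]) simp
  then have "int\<Omega> (\<lambda>x. ?F (\<xi> x)) = 0"
    by (rule integral_eq_zero_AE)
  moreover have "form (\<lambda>x. ?F (\<xi> x)) (\<lambda>x. ?F (\<xi> x)) \<le> form \<xi> (\<lambda>x. ?F (\<xi> x))"
    by (rule form_contraction[OF \<xi> v]) (auto intro: monoI)
  ultimately have "AE x in lebesgue. ?F (\<xi> x) = 0"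
    using eq by (intro form_definite[OF v]) simp
  then show ?thesis
    by eventually_elim (simp add: max_def split: if_splits)
qed

lemma elliptic_unique:
  assumes "elliptic_solution s \<Omega> \<Sigma>1 \<xi>" "elliptic_solution s \<Omega> \<Sigma>1 \<zeta>"
  shows "AE x in lebesgue. \<xi> x = \<zeta> x"
proof -
  have m: "\<xi> \<in> E" "\<zeta> \<in> E"
    using assms by (auto simp: elliptic_solution_def)
  note d = E_diff[OF m]
  have "form (\<lambda>x. \<xi> x - \<zeta> x) (\<lambda>x. \<xi> x - \<zeta> x) = 0"
    using form_add_scaled[OF m d, of 1 "-1"] assms d by (simp add: elliptic_solution_def)
  then have "AE x in lebesgue. \<xi> x - \<zeta> x = 0"
    by (intro form_definite[OF d]) simp
  then show ?thesis by simp
qed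

end

section \<open>Positive solutions of the heat equation\<close>

lemma tendsto_min_nat: "(\<lambda>n. min a (real n)) \<longlonglongrightarrow> a"
proof (rule tendsto_eventually)
  obtain N where N: "a \<le> real N"
    using real_arch_simple by blast
  show "\<forall>\<^sub>F n in sequentially. min a (real n) = a"
    using eventually_ge_at_top[of N] by eventually_elim (use N in \<open>auto simp: min_def\<close>)
qed

context mixed_domain
begin

text \<open>
  The constants of the lower bound for the mass, as functions of \<open>g = \<parallel>\<xi>\<parallel>\<^sup>2\<close>. With \<open>\<gamma> = \<beta> g / 4\<close>, the
  moment \<open>\<integral>u (\<xi>\<^sup>2 + \<gamma> \<xi>)\<close> decays at most at the rate \<open>1 / \<gamma> + \<beta> |\<Omega>|\<close>, and it lies
  between \<open>\<gamma> \<integral>u \<xi>\<close> and \<open>(C\<^sup>2 + \<gamma> C) \<integral>u\<close>; \<open>mass_factor\<close> is the quotient of these two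
  coefficients.
\<close>

definition mass_rate :: "real \<Rightarrow> real" where
  "mass_rate g = 4 / (\<beta> * g) + \<beta> * measure lebesgue \<Omega>"

definition mass_factor :: "real \<Rightarrow> real" where
  "mass_factor g = (\<beta> * g / 4) / (C\<^sup>2 + \<beta> * g / 4 * C)"

lemma mass_factor_pos: "0 < g \<Longrightarrow> 0 < mass_factor g"
  using \<beta>_pos C_pos unfolding mass_factor_def
  by (intro divide_pos_pos add_pos_pos mult_pos_pos) auto

text \<open>
  Let \<open>M\<close> be the lower bound for the mass on \<open>[0, T]\<close>, which is \<open>mass_factor g * exp (- mass_rate g * T)\<close>
  times \<open>\<integral>u\<^sub>0 \<xi>\<close>. Then \<open>a = slope g T * \<integral>u\<^sub>0 \<xi>\<close> is the solution of
  \<open>a C + a T = \<beta> (M - a T C |\<Omega>|)\<close>, the balance of gain and loss in the energy of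
  \<open>a t \<xi> - u(t)\<close>.
\<close>

definition slope :: "real \<Rightarrow> real \<Rightarrow> real" where
  "slope g T = \<beta> * (mass_factor g * exp (- mass_rate g * T)) / (C + T + \<beta> * T * (C * measure lebesgue \<Omega>))"

lemma slope_denominator_pos: "0 < T \<Longrightarrow> 0 < C + T + \<beta> * T * (C * measure lebesgue \<Omega>)"
  using C_pos \<beta>_pos \<Omega> by (intro add_pos_pos mult_pos_pos) auto

lemma slope_pos: "0 < g \<Longrightarrow> 0 < T \<Longrightarrow> 0 < slope g T"
  unfolding slope_def using \<beta>_pos mass_factor_pos slope_denominator_pos
  by (intro divide_pos_pos mult_pos_pos) auto

end

text \<open>
  The parabolic solution with its time derivative, in the form in which it is used: tested with
  functions of the energy space that do not depend on time.
\<close>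

locale heat_flow = mixed_domain +
  fixes u0 :: "'a \<Rightarrow> real" and u ut :: "real \<Rightarrow> 'a \<Rightarrow> real" and \<xi> :: "'a \<Rightarrow> real"
  assumes u_cont: "curve_cont {0..} (L2 \<Omega>) (L2_normsq \<Omega>) u"
    and u_E: "\<And>t. 0 < t \<Longrightarrow> u t \<in> E"
    and u_init: "AE x in lebesgue_on \<Omega>. u 0 x = u0 x"
    and u0_L2: "u0 \<in> L2 \<Omega>"
    and u0_nonneg: "AE x in lebesgue_on \<Omega>. 0 \<le> u0 x"
    and ut_L2: "\<And>t. 0 < t \<Longrightarrow> ut t \<in> L2 \<Omega>"
    and u_deriv: "\<And>t. 0 < t \<Longrightarrow> L2_curve_deriv \<Omega> u (ut t) t"
    and weak: "\<And>t \<phi>. 0 < t \<Longrightarrow> \<phi> \<in> E \<Longrightarrow> int\<Omega> (\<lambda>x. ut t x * \<phi> x) = - form (u t) \<phi>"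
    and elliptic: "elliptic_solution s \<Omega> \<Sigma>1 \<xi>"
begin

lemma u_L2: "0 \<le> t \<Longrightarrow> u t \<in> L2 \<Omega>"
  using u_cont by (auto simp: curve_cont_def)

lemma \<xi>_E: "\<xi> \<in> E"
  and form_\<xi>: "\<phi> \<in> E \<Longrightarrow> form \<xi> \<phi> = int\<Omega> \<phi>"
  using elliptic by (auto simp: elliptic_solution_def)

lemmas \<xi>_nonneg = elliptic_nonneg[OF elliptic]
lemmas \<xi>_le = elliptic_bounded[OF elliptic]
lemmas \<xi>_L2 = E_L2[OF \<xi>_E]

text \<open>
  The excess of the barrier \<open>a t \<xi>\<close> over the solution; \<open>a = 0\<close> serves to prove positivity.
\<close>

definition gap :: "real \<Rightarrow> real \<Rightarrow> 'a \<Rightarrow> real" where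
  "gap a t x = a * t * \<xi> x - u t x"

lemma gap_L2: "0 \<le> t \<Longrightarrow> gap a t \<in> L2 \<Omega>"
  using L2_add_scaled[OF \<xi>_L2 u_L2, of t "a * t" "-1"] by (simp add: gap_def[abs_def])

lemma gap_E: "0 < t \<Longrightarrow> gap a t \<in> E"
  using E_add_scaled[OF \<xi>_E u_E, of t "a * t" "-1"] by (simp add: gap_def[abs_def])

lemma gap_deriv:
  assumes "0 < t"
  shows "L2_curve_deriv \<Omega> (gap a) (\<lambda>x. a * \<xi> x - ut t x) t"
proof -
  have "((\<lambda>h. L2_normsq \<Omega> (\<lambda>x. (u (t + h) x - u t x) / h - ut t x)) \<longlongrightarrow> 0) (at 0)"
    using u_deriv[OF assms] by (simp add: L2_curve_deriv_def)
  then show ?thesis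
    unfolding L2_curve_deriv_def
  proof (rule Lim_transform_eventually)
    show "\<forall>\<^sub>F h in at 0. L2_normsq \<Omega> (\<lambda>x. (u (t + h) x - u t x) / h - ut t x) =
        L2_normsq \<Omega> (\<lambda>x. (gap a (t + h) x - gap a t x) / h - (a * \<xi> x - ut t x))"
      using eventually_neq_at_within[of 0]
    proof eventually_elim
      case (elim h)
      have "(gap a (t + h) x - gap a t x) / h - (a * \<xi> x - ut t x)
          = - ((u (t + h) x - u t x) / h - ut t x)" for x
        using elim by (simp add: gap_def field_simps)
      then show ?case
        by (simp only: power2_minus L2_normsq_def)
    qed
  qed
qed

lemma gap_cont0: "((\<lambda>r. L2_normsq \<Omega> (\<lambda>x. gap a r x - gap a 0 x)) \<longlongrightarrow> 0) (at 0 within {0..})"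
proof -
  have ev: "\<forall>\<^sub>F r in at 0 within {0..}. (\<lambda>x. u r x - u 0 x) \<in> L2 \<Omega>"
    using u_L2 by (auto simp: eventually_at_filter intro!: always_eventually L2_diff)
  have "((\<lambda>r. L2_normsq \<Omega> (\<lambda>x. u r x - u 0 x)) \<longlongrightarrow> 0) (at 0 within {0..})"
    using u_cont by (auto simp: curve_cont_def)
  from tendsto_L2_square[OF this ev]
  have "((\<lambda>r. 2 * (a * r)\<^sup>2 * int\<Omega> (\<lambda>x. (\<xi> x)\<^sup>2) + 2 * int\<Omega> (\<lambda>x. (u r x - u 0 x)\<^sup>2))
      \<longlongrightarrow> 2 * (a * 0)\<^sup>2 * int\<Omega> (\<lambda>x. (\<xi> x)\<^sup>2) + 2 * 0) (at 0 within {0..})"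
    by (intro tendsto_intros)
  then have lim: "((\<lambda>r. ennreal (2 * (a * r)\<^sup>2 * int\<Omega> (\<lambda>x. (\<xi> x)\<^sup>2) + 2 * int\<Omega> (\<lambda>x. (u r x - u 0 x)\<^sup>2)))
      \<longlongrightarrow> 0) (at 0 within {0..})"
    by (auto dest: tendsto_ennrealI)
  show ?thesis
  proof (rule tendsto_sandwich[OF _ _ tendsto_const lim])
    show "\<forall>\<^sub>F r in at 0 within {0..}. L2_normsq \<Omega> (\<lambda>x. gap a r x - gap a 0 x) \<le>
      ennreal (2 * (a * r)\<^sup>2 * int\<Omega> (\<lambda>x. (\<xi> x)\<^sup>2) + 2 * int\<Omega> (\<lambda>x. (u r x - u 0 x)\<^sup>2))"
      unfolding eventually_at_filter
    proof (intro always_eventually allI impI)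
      fix r :: real assume "r \<in> {0..}"
      then have r: "0 \<le> r" by simp
      note d = L2_diff[OF u_L2[OF r] u_L2[of 0]]
      have "int\<Omega> (\<lambda>x. (gap a r x - gap a 0 x)\<^sup>2)
          \<le> int\<Omega> (\<lambda>x. 2 * (a * r)\<^sup>2 * (\<xi> x)\<^sup>2 + 2 * (u r x - u 0 x)\<^sup>2)"
      proof (rule integral_mono)
        fix x
        have "gap a r x - gap a 0 x = a * r * \<xi> x + - (u r x - u 0 x)"
          by (simp add: gap_def)
        then show "(gap a r x - gap a 0 x)\<^sup>2 \<le> 2 * (a * r)\<^sup>2 * (\<xi> x)\<^sup>2 + 2 * (u r x - u 0 x)\<^sup>2"
          using square_add_le[of "a * r * \<xi> x" "- (u r x - u 0 x)"]
          by (simp only: power2_minus power_mult_distrib mult.assoc)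
      qed (use L2_integrable_square[OF L2_diff[OF gap_L2[OF r] gap_L2[of 0]]] L2_integrable_square[OF d]
          L2_integrable_square[OF \<xi>_L2] in auto)
      also have "\<dots> = 2 * (a * r)\<^sup>2 * int\<Omega> (\<lambda>x. (\<xi> x)\<^sup>2) + 2 * int\<Omega> (\<lambda>x. (u r x - u 0 x)\<^sup>2)"
        using L2_integrable_square[OF d] L2_integrable_square[OF \<xi>_L2] by simp
      finally show "L2_normsq \<Omega> (\<lambda>x. gap a r x - gap a 0 x) \<le>
        ennreal (2 * (a * r)\<^sup>2 * int\<Omega> (\<lambda>x. (\<xi> x)\<^sup>2) + 2 * int\<Omega> (\<lambda>x. (u r x - u 0 x)\<^sup>2))"
        unfolding L2_normsq_eq[OF L2_diff[OF gap_L2[OF r] gap_L2[OF order.refl]]] by (rule ennreal_leI)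
    qed
  qed auto
qed

text \<open>
  The equation for \<open>u\<close> and the elliptic equation, both tested with the positive part of the gap.
\<close>

lemma gap_energy:
  assumes t: "0 < t"
  shows "int\<Omega> (\<lambda>x. (a * \<xi> x - ut t x) * max (gap a t x) 0) =
    a * int\<Omega> (\<lambda>x. \<xi> x * max (gap a t x) 0) + a * t * int\<Omega> (\<lambda>x. max (gap a t x) 0)
    - form (gap a t) (\<lambda>x. max (gap a t x) 0)"
proof -
  let ?v = "\<lambda>x. max (gap a t x) 0"
  have v: "?v \<in> E"
    by (rule E_pos_part[OF gap_E[OF t]])
  have "int\<Omega> (\<lambda>x. (a * \<xi> x - ut t x) * ?v x) = int\<Omega> (\<lambda>x. a * (\<xi> x * ?v x) - ut t x * ?v x)"
    by (rule Bochner_Integration.integral_cong) (auto simp: algebra_simps)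
  also have "\<dots> = a * int\<Omega> (\<lambda>x. \<xi> x * ?v x) + form (u t) ?v"
    using L2_mult_integrable[OF \<xi>_L2 E_L2[OF v]] L2_mult_integrable[OF ut_L2[OF t] E_L2[OF v]] weak[OF t v]
    by simp
  also have "form (u t) ?v = a * t * int\<Omega> ?v - form (gap a t) ?v"
    using form_add_scaled[OF \<xi>_E u_E[OF t] v, of "a * t" "-1"] form_\<xi>[OF v]
    by (simp add: gap_def[abs_def])
  finally show ?thesis by simp
qed

lemma below_solution:
  assumes sign: "\<And>r. 0 < r \<Longrightarrow> r < T \<Longrightarrow>
      a * int\<Omega> (\<lambda>x. \<xi> x * max (gap a r x) 0) + a * r * int\<Omega> (\<lambda>x. max (gap a r x) 0)
        \<le> form (gap a r) (\<lambda>x. max (gap a r x) 0)"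
    and t: "0 \<le> t" "t < T"
  shows "AE x in lebesgue_on \<Omega>. gap a t x \<le> 0"
proof (rule pos_part_vanishes[OF gap_L2 _ gap_cont0, where w' = "\<lambda>t x. a * \<xi> x - ut t x"])
  show "AE x in lebesgue_on \<Omega>. gap a 0 x \<le> 0"
    using u_init u0_nonneg by eventually_elim (simp add: gap_def)
  show "(\<lambda>x. a * \<xi> x - ut r x) \<in> L2 \<Omega>" if "0 < r" for r
    using L2_add_scaled[OF \<xi>_L2 ut_L2[OF that], of a "-1"] by simp
  show "int\<Omega> (\<lambda>x. (a * \<xi> x - ut r x) * max (gap a r x) 0) \<le> 0" if "0 < r" "r < T" for r
    using sign[OF that] gap_energy[OF that(1)] by simp
qed (use t gap_deriv in auto)

lemma u_nonneg:
  assumes "0 \<le> t"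
  shows "AE x in lebesgue_on \<Omega>. 0 \<le> u t x"
proof -
  have "AE x in lebesgue_on \<Omega>. gap 0 t x \<le> 0"
  proof (rule below_solution[where T = "t + 1"])
    show "0 * int\<Omega> (\<lambda>x. \<xi> x * max (gap 0 r x) 0) + 0 * r * int\<Omega> (\<lambda>x. max (gap 0 r x) 0)
        \<le> form (gap 0 r) (\<lambda>x. max (gap 0 r x) 0)" if "0 < r" for r
    proof -
      have "0 \<le> \<beta> * int\<Omega> (\<lambda>x. max (- gap 0 r x) 0) * int\<Omega> (\<lambda>x. max (gap 0 r x) 0)"
        using \<beta>_pos by (intro mult_nonneg_nonneg) auto
      with form_pos_part_ge[OF gap_E[OF that, of 0]] show ?thesis
        by simp
    qed
  qed (use assms in auto)
  then show ?thesis
    by eventually_elim (simp add: gap_def)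
qed

text \<open>
  Once \<open>u(t)\<^sup>-\<close> vanishes on \<open>\<Omega>\<close>, its energy is zero by the equation, hence it vanishes also outside.
  The values there enter the estimate for \<open>\<xi>\<^sup>2\<close>, which involves the sums \<open>u(x) + u(y)\<close>.
\<close>

lemma u_nonneg_everywhere:
  assumes t: "0 < t"
  shows "AE x in lebesgue. 0 \<le> u t x"
proof -
  let ?v = "\<lambda>x. max (- u t x) 0"
  have v: "?v \<in> E"
    by (rule E_pos_part[OF E_uminus[OF u_E[OF t]]])
  have "int\<Omega> (\<lambda>x. ut t x * ?v x) = 0"
    by (rule integral_eq_zero_AE) (use u_nonneg[of t] t in \<open>auto elim!: eventually_mono\<close>)
  then have "form (\<lambda>x. - u t x) ?v = 0"
    using form_uminus[OF u_E[OF t] v] weak[OF t v] by simp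
  then have "AE x in lebesgue. - u t x \<le> 0"
    by (intro pos_part_vanishes_of_form E_uminus u_E t) simp
  then show ?thesis by simp
qed

section \<open>Decay of the mass is at most exponential\<close>

abbreviation "\<xi>sq \<equiv> \<lambda>x. \<xi> x * \<xi> x"

lemma abs_\<xi>_le: "AE x in lebesgue. \<bar>\<xi> x\<bar> \<le> C"
  using \<xi>_nonneg \<xi>_le by eventually_elim auto

lemma \<xi>sq_E: "\<xi>sq \<in> E"
  by (rule E_mult_bounded[OF \<xi>_E \<xi>_E abs_\<xi>_le abs_\<xi>_le])

definition G :: real where "G = int\<Omega> (\<lambda>x. (\<xi> x)\<^sup>2)"

text \<open>
  The product rule
  \<open>2 (X - Y) (X V - Y W) - (V - W) (X\<^sup>2 - Y\<^sup>2) = (X - Y)\<^sup>2 (V + W)\<close> expresses \<open>\<E>(v, \<xi>\<^sup>2)\<close> by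
  \<open>2 \<E>(\<xi>, \<xi> v) = 2 \<integral>\<xi> v\<close>, minus a nonnegative term. That term is bounded below by its part in
  \<open>\<Omega> \<times> \<Omega>\<close>. Boundedness of \<open>v\<close> makes \<open>\<xi> v\<close> an admissible test function.
\<close>

lemma form_truncated_\<xi>sq:
  assumes v: "v \<in> E" and v0: "AE x in lebesgue. 0 \<le> v x" and vb: "AE x in lebesgue. v x \<le> b"
  shows "form v \<xi>sq \<le> 2 * int\<Omega> (\<lambda>x. v x * \<xi> x) - \<beta> * G / 2 * int\<Omega> v
      + \<beta> * measure lebesgue \<Omega> * int\<Omega> (\<lambda>x. v x * \<xi>sq x)"
proof -
  have "AE x in lebesgue. \<bar>v x\<bar> \<le> b"
    using v0 vb by eventually_elim auto
  then have \<xi>v: "(\<lambda>x. \<xi> x * v x) \<in> E"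
    by (rule E_mult_bounded[OF \<xi>_E v abs_\<xi>_le])
  define H where "H p = 2 * (jump \<xi> p * jump (\<lambda>x. \<xi> x * v x) p * w p) - jump v p * jump \<xi>sq p * w p" for p
  have H_eq: "H p = (jump \<xi> p)\<^sup>2 * (v (fst p) + v (snd p)) * w p" for p
    by (simp add: H_def jump_def power2_eq_square algebra_simps)
  note ints = E_jump_product[OF \<xi>_E \<xi>v] E_jump_product[OF v \<xi>sq_E]
  have H_int: "integrable lebesgue2 H"
    unfolding H_def[abs_def] using ints by auto
  have form_H: "frac_const DIM('a) s / 2 * (LINT p|lebesgue2. H p) = 2 * int\<Omega> (\<lambda>x. v x * \<xi> x) - form v \<xi>sq"
  proof -
    have H_split: "(LINT p|lebesgue2. H p) = 2 * (LINT p|lebesgue2. jump \<xi> p * jump (\<lambda>x. \<xi> x * v x) p * w p)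
        - (LINT p|lebesgue2. jump v p * jump \<xi>sq p * w p)"
      unfolding H_def using ints by simp
    have "frac_const DIM('a) s / 2 * (LINT p|lebesgue2. H p) = 2 * form \<xi> (\<lambda>x. \<xi> x * v x) - form v \<xi>sq"
      unfolding E_form_eq H_split by (simp add: right_diff_distrib)
    then show ?thesis
      using form_\<xi>[OF \<xi>v] by (simp add: mult.commute)
  qed
  let ?v = "\<lambda>x. indicator \<Omega> x * v x" and ?\<xi>2 = "\<lambda>x. indicator \<Omega> x * ((\<xi> x)\<^sup>2 / 2)"
    and ?v\<xi>2 = "\<lambda>x. indicator \<Omega> x * (v x * \<xi>sq x)" and ?one = "\<lambda>x. indicator \<Omega> x * (1::real)"
  have i: "integrable lebesgue ?v" "integrable lebesgue ?\<xi>2" "integrable lebesgue ?v\<xi>2" "integrable lebesgue ?one"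
    unfolding integrable_on_\<Omega>[symmetric]
    using L2_integrable[OF E_L2[OF v]] L2_integrable_square[OF \<xi>_L2]
      L2_mult_integrable[OF E_L2[OF v] E_L2[OF \<xi>sq_E]] L2_integrable[OF one_L2] by auto
  note prod = integral_product[OF i(3,4)]
  have "\<beta> * (LINT x|lebesgue. ?v x) * (LINT y|lebesgue. ?\<xi>2 y)
      \<le> frac_const DIM('a) s / 2 * (LINT p|lebesgue2. H p + \<kappa> * (?v\<xi>2 (fst p) * ?one (snd p)))"
  proof (rule integral_ge_product[OF _ i(1,2)])
    show "integrable lebesgue2 (\<lambda>p. H p + \<kappa> * (?v\<xi>2 (fst p) * ?one (snd p)))"
      using H_int prod(1) by auto
    show "AE p in lebesgue2. \<kappa> * (?v (fst p) * ?\<xi>2 (snd p)) \<le> H p + \<kappa> * (?v\<xi>2 (fst p) * ?one (snd p))"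
      using AE_pair_fst_snd[OF v0]
    proof eventually_elim
      case (elim p)
      have H0: "0 \<le> H p"
        unfolding H_eq using elim by (intro mult_nonneg_nonneg weight_nonneg) auto
      show ?case
      proof (cases "fst p \<in> \<Omega> \<and> snd p \<in> \<Omega>")
        case False
        then show ?thesis
          using H0 by (auto simp: indicator_def)
      next
        case True
        \<comment> \<open>\<open>\<xi>(y)\<^sup>2 / 2 \<le> (\<xi>(x) - \<xi>(y))\<^sup>2 + \<xi>(x)\<^sup>2\<close>; only the first summand is paid for by the energy.\<close>
        have "\<kappa> * (jump \<xi> p)\<^sup>2 * v (fst p) \<le> H p"
        proof (cases "fst p = snd p")
          case True
          then show ?thesis using H0 by (simp add: jump_def)
        next
          case False
          have "\<kappa> * ((jump \<xi> p)\<^sup>2 * v (fst p)) \<le> w p * ((jump \<xi> p)\<^sup>2 * (v (fst p) + v (snd p)))"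
            using elim \<kappa> True False
            by (intro mult_mono[OF weight_ge] mult_left_mono weight_nonneg mult_nonneg_nonneg) auto
          then show ?thesis by (simp add: H_eq ac_simps)
        qed
        moreover have "(\<xi> (snd p))\<^sup>2 / 2 \<le> (jump \<xi> p)\<^sup>2 + (\<xi> (fst p))\<^sup>2"
          using square_add_le[of "- jump \<xi> p" "\<xi> (fst p)"]
          by (simp add: jump_def power2_commute[of "\<xi> (snd p)"])
        then have "\<kappa> * v (fst p) * ((\<xi> (snd p))\<^sup>2 / 2) \<le> \<kappa> * v (fst p) * ((jump \<xi> p)\<^sup>2 + (\<xi> (fst p))\<^sup>2)"
          using elim \<kappa> by (intro mult_left_mono) auto
        ultimately show ?thesis
          using True by (simp add: algebra_simps power2_eq_square)
      qed
    qed
  qed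
  also have "(LINT p|lebesgue2. H p + \<kappa> * (?v\<xi>2 (fst p) * ?one (snd p)))
      = (LINT p|lebesgue2. H p) + \<kappa> * ((LINT x|lebesgue. ?v\<xi>2 x) * (LINT x|lebesgue. ?one x))"
    using H_int prod(1) unfolding prod(2)[symmetric] by simp
  also have "frac_const DIM('a) s / 2 * \<dots> = 2 * int\<Omega> (\<lambda>x. v x * \<xi> x) - form v \<xi>sq
      + \<beta> * (int\<Omega> (\<lambda>x. v x * \<xi>sq x) * measure lebesgue \<Omega>)"
    unfolding distrib_left form_H using \<Omega>_sets by (simp add: \<beta>_def integral_on_\<Omega>[of "\<lambda>x. v x * \<xi>sq x"])
  also have "(LINT x|lebesgue. ?v x) = int\<Omega> v"
    by (rule integral_on_\<Omega>[symmetric])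
  also have "(LINT x|lebesgue. ?\<xi>2 x) = G / 2"
    unfolding integral_on_\<Omega>[symmetric] G_def by simp
  finally show ?thesis
    by (simp add: algebra_simps)
qed

text \<open>
  The solution may be unbounded, so it is truncated at height \<open>n\<close>. Truncation shrinks values and
  increments, and all terms converge by dominated convergence.
\<close>

lemma form_u_\<xi>sq:
  assumes t: "0 < t"
  shows "form (u t) \<xi>sq \<le> 2 * int\<Omega> (\<lambda>x. u t x * \<xi> x) - \<beta> * G / 2 * int\<Omega> (u t)
      + \<beta> * measure lebesgue \<Omega> * int\<Omega> (\<lambda>x. u t x * \<xi>sq x)"
proof -
  let ?v = "\<lambda>(n::nat) x. min (u t x) (real n)"
  have v: "?v n \<in> E" for n
    by (rule E_contraction[OF u_E[OF t], of "\<lambda>r. min r (real n)"]) auto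
  have le: "form (?v n) \<xi>sq \<le> 2 * int\<Omega> (\<lambda>x. ?v n x * \<xi> x) - \<beta> * G / 2 * int\<Omega> (?v n)
      + \<beta> * measure lebesgue \<Omega> * int\<Omega> (\<lambda>x. ?v n x * \<xi>sq x)" for n
    by (rule form_truncated_\<xi>sq[OF v, of _ "real n"]) (use u_nonneg_everywhere[OF t] in auto)
  have trunc_abs: "\<bar>min r (real n)\<bar> \<le> \<bar>r\<bar>" for r n
    by auto
  have lim: "(\<lambda>n. int\<Omega> (\<lambda>x. ?v n x * \<phi> x)) \<longlonglongrightarrow> int\<Omega> (\<lambda>x. u t x * \<phi> x)" if \<phi>: "\<phi> \<in> L2 \<Omega>" for \<phi>
  proof (rule integral_dominated_convergence)
    note [measurable] = L2_measurable[OF \<phi>] L2_measurable[OF E_L2[OF u_E[OF t]]]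
    show "integrable (lebesgue_on \<Omega>) (\<lambda>x. \<bar>u t x * \<phi> x\<bar>)"
      using L2_mult_integrable[OF E_L2[OF u_E[OF t]] \<phi>] by simp
    show "(\<lambda>x. u t x * \<phi> x) \<in> borel_measurable (lebesgue_on \<Omega>)"
      "(\<lambda>x. ?v n x * \<phi> x) \<in> borel_measurable (lebesgue_on \<Omega>)" for n
      by measurable
    show "AE x in lebesgue_on \<Omega>. (\<lambda>n. ?v n x * \<phi> x) \<longlonglongrightarrow> u t x * \<phi> x"
      by (intro AE_I2 tendsto_mult_right tendsto_min_nat)
    show "AE x in lebesgue_on \<Omega>. norm (?v n x * \<phi> x) \<le> \<bar>u t x * \<phi> x\<bar>" for n
      using trunc_abs by (auto simp: abs_mult intro!: mult_right_mono)
  qed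
  have "(\<lambda>n. LINT p|lebesgue2. jump (?v n) p * jump \<xi>sq p * w p) \<longlonglongrightarrow>
      (LINT p|lebesgue2. jump (u t) p * jump \<xi>sq p * w p)"
  proof (rule integral_dominated_convergence)
    note [measurable] = E_measurable[OF v] E_measurable[OF \<xi>sq_E] E_measurable[OF u_E[OF t]]
    show "integrable lebesgue2 (\<lambda>p. \<bar>jump (u t) p * jump \<xi>sq p * w p\<bar>)"
      using E_jump_product[OF u_E[OF t] \<xi>sq_E] by simp
    show "(\<lambda>p. jump (u t) p * jump \<xi>sq p * w p) \<in> borel_measurable lebesgue2"
      "(\<lambda>p. jump (?v n) p * jump \<xi>sq p * w p) \<in> borel_measurable lebesgue2" for n
      using E_jump_product[OF u_E[OF t] \<xi>sq_E] E_jump_product[OF v \<xi>sq_E] by auto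
    have "(\<lambda>n. jump (?v n) p) \<longlonglongrightarrow> jump (u t) p" for p
      unfolding jump_def by (intro tendsto_diff tendsto_min_nat)
    then show "AE p in lebesgue2. (\<lambda>n. jump (?v n) p * jump \<xi>sq p * w p) \<longlonglongrightarrow> jump (u t) p * jump \<xi>sq p * w p"
      by (intro AE_I2 tendsto_mult_right)
    have "\<bar>jump (?v n) p\<bar> \<le> \<bar>jump (u t) p\<bar>" for n p
      by (auto simp: jump_def min_def)
    then show "AE p in lebesgue2. norm (jump (?v n) p * jump \<xi>sq p * w p) \<le> \<bar>jump (u t) p * jump \<xi>sq p * w p\<bar>" for n
      by (auto simp: abs_mult intro!: mult_right_mono AE_I2)
  qed
  then have lim_form: "(\<lambda>n. form (?v n) \<xi>sq) \<longlonglongrightarrow> form (u t) \<xi>sq"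
    unfolding E_form_eq by (rule tendsto_mult_left)
  have lim1: "(\<lambda>n. int\<Omega> (?v n)) \<longlonglongrightarrow> int\<Omega> (u t)"
    using lim[OF one_L2] by simp
  have "(\<lambda>n. 2 * int\<Omega> (\<lambda>x. ?v n x * \<xi> x) - \<beta> * G / 2 * int\<Omega> (?v n)
      + \<beta> * measure lebesgue \<Omega> * int\<Omega> (\<lambda>x. ?v n x * \<xi>sq x))
    \<longlonglongrightarrow> 2 * int\<Omega> (\<lambda>x. u t x * \<xi> x) - \<beta> * G / 2 * int\<Omega> (u t)
      + \<beta> * measure lebesgue \<Omega> * int\<Omega> (\<lambda>x. u t x * \<xi>sq x)"
    by (intro tendsto_intros lim lim1 \<xi>_L2 E_L2[OF \<xi>sq_E])
  from LIMSEQ_le[OF lim_form this] show ?thesis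
    using le by blast
qed

text \<open>
  Neither moment \<open>f = \<integral>u \<xi>\<close>, \<open>p = \<integral>u \<xi>\<^sup>2\<close> is controlled by itself: \<open>f\<close> loses \<open>m = \<integral>u\<close>, and \<open>p\<close> loses
  \<open>2 f + \<beta> |\<Omega>| p\<close>. But \<open>p\<close> gains \<open>2 \<gamma> m\<close>; one half of this absorbs \<open>2 f \<le> p / \<gamma> + \<gamma> m\<close>, the other half the
  loss of \<open>\<gamma> f\<close>. Hence \<open>exp(\<lambda> t) (p + \<gamma> f)\<close> increases.
\<close>

lemma mass_ge:
  assumes G: "0 < G" and t: "0 < t"
  shows "mass_factor G * exp (- mass_rate G * t) * int\<Omega> (\<lambda>x. u0 x * \<xi> x) \<le> int\<Omega> (u t)"
proof -
  define \<gamma> where "\<gamma> = \<beta> * G / 4"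
  define f p m where "f r = int\<Omega> (\<lambda>x. u r x * \<xi> x)" and "p r = int\<Omega> (\<lambda>x. u r x * \<xi>sq x)"
    and "m r = int\<Omega> (u r)" for r
  have two_\<gamma>: "2 * \<gamma> = \<beta> * G / 2"
    by (simp add: \<gamma>_def)
  have \<gamma>: "0 < \<gamma>"
    using G \<beta>_pos by (simp add: \<gamma>_def)
  note \<xi>sq_L2 = E_L2[OF \<xi>sq_E]
  have int_f: "integrable (lebesgue_on \<Omega>) (\<lambda>x. u r x * \<xi> x)"
    and int_p: "integrable (lebesgue_on \<Omega>) (\<lambda>x. u r x * \<xi>sq x)"
    and int_m: "integrable (lebesgue_on \<Omega>) (u r)" if "0 \<le> r" for r
    using that by (auto intro: L2_mult_integrable L2_integrable u_L2 \<xi>_L2 \<xi>sq_L2)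
  note \<xi>_bounds = AE_on_\<Omega>I[OF \<xi>_nonneg] AE_on_\<Omega>I[OF \<xi>_le]
  have f_nonneg: "0 \<le> f r" and p_nonneg: "0 \<le> p r" if "0 \<le> r" for r
    unfolding f_def p_def using u_nonneg[OF that] \<xi>_bounds(1)
    by (auto intro!: integral_nonneg_AE elim: eventually_elim2)
  have f_deriv: "(f has_real_derivative - m r) (at r)" if r: "0 < r" for r
    using curve_product_deriv[OF u_L2 ut_L2[OF r] \<xi>_L2 r u_deriv[OF r]]
      weak[OF r \<xi>_E] form_\<xi>[OF u_E[OF r]] form_commute[of "u r" \<xi>]
    by (simp add: f_def[abs_def] m_def)
  have p_deriv: "(p has_real_derivative - form (u r) \<xi>sq) (at r)" if r: "0 < r" for r
    using curve_product_deriv[OF u_L2 ut_L2[OF r] \<xi>sq_L2 r u_deriv[OF r]] weak[OF r \<xi>sq_E]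
    by (simp add: p_def[abs_def])
  have f_le: "2 * f r \<le> 1 / \<gamma> * p r + \<gamma> * m r" if r: "0 \<le> r" for r
  proof -
    have "int\<Omega> (\<lambda>x. 2 * (u r x * \<xi> x)) \<le> int\<Omega> (\<lambda>x. 1 / \<gamma> * (u r x * \<xi>sq x) + \<gamma> * u r x)"
    proof (rule integral_mono_AE)
      show "AE x in lebesgue_on \<Omega>. 2 * (u r x * \<xi> x) \<le> 1 / \<gamma> * (u r x * \<xi>sq x) + \<gamma> * u r x"
        using u_nonneg[OF r]
      proof eventually_elim
        case (elim x)
        \<comment> \<open>Young's inequality \<open>2 \<xi> \<le> \<xi>\<^sup>2 / \<gamma> + \<gamma>\<close>.\<close>
        have "0 \<le> 1 / \<gamma> * (\<xi> x - \<gamma>)\<^sup>2"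
          using \<gamma> by simp
        also have "\<dots> = 1 / \<gamma> * \<xi>sq x + \<gamma> - 2 * \<xi> x"
          using \<gamma> by (simp add: power2_eq_square field_simps)
        finally have "u r x * (2 * \<xi> x) \<le> u r x * (1 / \<gamma> * \<xi>sq x + \<gamma>)"
          using elim by (intro mult_left_mono) auto
        then show ?case by (simp add: algebra_simps)
      qed
    qed (use int_f[OF r] int_p[OF r] int_m[OF r] in auto)
    then show ?thesis
      using int_f[OF r] int_p[OF r] int_m[OF r] by (simp add: f_def p_def m_def)
  qed
  define P where "P r = exp (mass_rate G * r) * (p r + \<gamma> * f r)" for r
  have "P 0 \<le> P t"
  proof (rule DERIV_nonneg_imp_increasing_open[where f = P])
    fix r assume r: "0 < r" "r < t"
    have "(P has_real_derivative (exp (mass_rate G * r) * (- form (u r) \<xi>sq + \<gamma> * (- m r))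
        + mass_rate G * exp (mass_rate G * r) * (p r + \<gamma> * f r))) (at r)"
      unfolding P_def[abs_def]
      by (rule derivative_eq_intros f_deriv[OF r(1)] p_deriv[OF r(1)] refl | simp)+
    moreover have "0 \<le> exp (mass_rate G * r) * (- form (u r) \<xi>sq + \<gamma> * (- m r))
        + mass_rate G * exp (mass_rate G * r) * (p r + \<gamma> * f r)"
    proof -
      have rate: "mass_rate G = 1 / \<gamma> + \<beta> * measure lebesgue \<Omega>" "0 \<le> mass_rate G"
        using \<gamma> \<beta>_pos by (auto simp: mass_rate_def \<gamma>_def)
      have "form (u r) \<xi>sq \<le> 2 * f r - 2 * \<gamma> * m r + \<beta> * measure lebesgue \<Omega> * p r"
        using form_u_\<xi>sq[OF r(1)] unfolding two_\<gamma> f_def p_def m_def .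
      also have "\<dots> \<le> mass_rate G * p r - \<gamma> * m r"
        using f_le[of r] r by (simp add: rate(1) algebra_simps)
      also have "\<dots> \<le> mass_rate G * (p r + \<gamma> * f r) - \<gamma> * m r"
        using f_nonneg[of r] r \<gamma> rate(2) by (simp add: distrib_left)
      finally have "0 \<le> exp (mass_rate G * r) * (mass_rate G * (p r + \<gamma> * f r) - \<gamma> * m r - form (u r) \<xi>sq)"
        by (intro mult_nonneg_nonneg) auto
      then show ?thesis by (simp add: algebra_simps)
    qed
    ultimately show "\<exists>y. (P has_real_derivative y) (at r) \<and> 0 \<le> y"
      by blast
  next
    have "continuous_on {0..} f" "continuous_on {0..} p"
      unfolding f_def[abs_def] p_def[abs_def]
      by (rule curve_product_continuous[OF u_cont \<xi>_L2], rule curve_product_continuous[OF u_cont \<xi>sq_L2])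
    then have "continuous_on {0..t} f" "continuous_on {0..t} p"
      by (auto intro: continuous_on_subset)
    then show "continuous_on {0..t} P"
      unfolding P_def[abs_def] by (intro continuous_intros)
  qed (use t in auto)
  then have "\<gamma> * f 0 \<le> exp (mass_rate G * t) * (p t + \<gamma> * f t)"
    using p_nonneg[of 0] by (simp add: P_def)
  also have "p t + \<gamma> * f t \<le> (C\<^sup>2 + \<gamma> * C) * m t"
  proof -
    have "int\<Omega> (\<lambda>x. u t x * \<xi>sq x + \<gamma> * (u t x * \<xi> x)) \<le> int\<Omega> (\<lambda>x. (C\<^sup>2 + \<gamma> * C) * u t x)"
    proof (rule integral_mono_AE)
      show "AE x in lebesgue_on \<Omega>. u t x * \<xi>sq x + \<gamma> * (u t x * \<xi> x) \<le> (C\<^sup>2 + \<gamma> * C) * u t x"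
        using u_nonneg[OF less_imp_le[OF t]] \<xi>_bounds
      proof eventually_elim
        case (elim x)
        have "\<xi> x * \<xi> x + \<gamma> * \<xi> x \<le> C * C + \<gamma> * C"
          using elim \<gamma> C_pos by (intro add_mono mult_mono mult_left_mono) auto
        then have "u t x * (\<xi> x * \<xi> x + \<gamma> * \<xi> x) \<le> u t x * (C * C + \<gamma> * C)"
          using elim by (intro mult_left_mono)
        then show ?case by (simp add: algebra_simps power2_eq_square)
      qed
    qed (use int_f[of t] int_p[of t] int_m[of t] t in auto)
    then show ?thesis
      using int_f[of t] int_p[of t] t by (simp add: f_def p_def m_def)
  qed
  finally have main: "\<gamma> * f 0 \<le> exp (mass_rate G * t) * ((C\<^sup>2 + \<gamma> * C) * m t)"
    by simp
  have f0: "f 0 = int\<Omega> (\<lambda>x. u0 x * \<xi> x)"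
    unfolding f_def
  proof (rule Bochner_Integration.integral_cong_AE)
    show "AE x in lebesgue_on \<Omega>. u 0 x * \<xi> x = u0 x * \<xi> x"
      using u_init by eventually_elim simp
  qed (use L2_mult_integrable[OF u_L2 \<xi>_L2] L2_mult_integrable[OF u0_L2 \<xi>_L2] in auto)
  have pos: "0 < C\<^sup>2 + \<gamma> * C"
    using C_pos \<gamma> by (simp add: add_pos_pos)
  have "\<gamma> * f 0 * exp (- mass_rate G * t) \<le> (C\<^sup>2 + \<gamma> * C) * m t"
    using main by (simp add: exp_minus field_simps)
  then have "\<gamma> * f 0 * exp (- mass_rate G * t) / (C\<^sup>2 + \<gamma> * C) \<le> m t"
    using pos by (simp add: divide_le_eq mult.commute)
  moreover have "mass_factor G = \<gamma> / (C\<^sup>2 + \<gamma> * C)"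
    by (simp only: mass_factor_def \<gamma>_def)
  ultimately show ?thesis
    unfolding f0[symmetric] m_def by (simp add: ac_simps)
qed

section \<open>The lower bound\<close>

lemma integral_\<xi>_le: "int\<Omega> \<xi> \<le> C * measure lebesgue \<Omega>"
proof -
  have "int\<Omega> \<xi> \<le> int\<Omega> (\<lambda>x. C)"
    using L2_integrable[OF \<xi>_L2] L2_integrable[OF L2_add_scaled[OF one_L2 one_L2, of C 0]]
    by (intro integral_mono_AE AE_on_\<Omega>I[OF \<xi>_le]) auto
  then show ?thesis
    using \<Omega>_sets by (simp add: measure_restrict_space mult.commute)
qed

text \<open>
  With \<open>v\<close> the positive part of \<open>a r \<xi> - u(r)\<close>, the gain is at most \<open>(a C + a T) \<integral>v\<close> and the loss
  at least \<open>\<beta> (\<integral>u(r) - a r \<integral>\<xi>) \<integral>v\<close>. The slope balances the two on \<open>[0, T]\<close>. The horizon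
  \<open>T = t + 1\<close> leaves room beyond \<open>t\<close>, since the comparison holds for times strictly before \<open>T\<close>.
\<close>

lemma solution_ge:
  assumes G: "0 < G" and t: "0 < t"
  shows "AE x in lebesgue_on \<Omega>. slope G (t + 1) * t * int\<Omega> (\<lambda>y. u0 y * \<xi> y) * \<xi> x \<le> u t x"
proof -
  define T where "T = t + 1"
  define D where "D = C + T + \<beta> * T * (C * measure lebesgue \<Omega>)"
  define f0 where "f0 = int\<Omega> (\<lambda>y. u0 y * \<xi> y)"
  define a where "a = slope G T * f0"
  have T: "0 < T" "t < T"
    using t by (auto simp: T_def)
  have D: "0 < D"
    using slope_denominator_pos[OF T(1)] by (simp add: D_def)
  have f0: "0 \<le> f0"
    unfolding f0_def using u0_nonneg AE_on_\<Omega>I[OF \<xi>_nonneg]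
    by (auto intro!: integral_nonneg_AE elim: eventually_elim2)
  have factor: "0 \<le> mass_factor G"
    using G \<beta>_pos C_pos by (simp add: mass_factor_def)
  then have a: "0 \<le> a"
    using f0 \<beta>_pos D by (simp add: a_def slope_def D_def[symmetric])
  have "AE x in lebesgue_on \<Omega>. gap a t x \<le> 0"
  proof (rule below_solution[where T = T])
    fix r assume r: "0 < r" "r < T"
    let ?v = "\<lambda>x. max (gap a r x) 0"
    note gE = gap_E[OF r(1), of a]
    note v_int = L2_integrable[OF E_L2[OF E_pos_part[OF gE]]]
    have v_nonneg: "0 \<le> int\<Omega> ?v"
      by simp
    have "int\<Omega> (\<lambda>x. \<xi> x * ?v x) \<le> int\<Omega> (\<lambda>x. C * ?v x)"
    proof (rule integral_mono_AE)
      show "AE x in lebesgue_on \<Omega>. \<xi> x * ?v x \<le> C * ?v x"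
        using AE_on_\<Omega>I[OF \<xi>_le] by eventually_elim (auto intro: mult_right_mono)
    qed (use L2_mult_integrable[OF \<xi>_L2 E_L2[OF E_pos_part[OF gE]]] v_int in auto)
    then have le1: "a * int\<Omega> (\<lambda>x. \<xi> x * ?v x) \<le> a * (C * int\<Omega> ?v)"
      using a by (intro mult_left_mono) auto
    have le2: "a * r * int\<Omega> ?v \<le> a * T * int\<Omega> ?v"
      using a r v_nonneg by (intro mult_right_mono mult_left_mono) auto
    have "mass_factor G * exp (- mass_rate G * T) * f0 \<le> mass_factor G * exp (- mass_rate G * r) * f0"
    proof -
      have "0 \<le> mass_rate G"
        using G \<beta>_pos by (simp add: mass_rate_def)
      then have "exp (- mass_rate G * T) \<le> exp (- mass_rate G * r)"
        using r by (simp add: mult_left_mono)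
      then show ?thesis
        using factor f0 by (intro mult_right_mono mult_left_mono) auto
    qed
    also have "\<dots> \<le> int\<Omega> (u r)"
      using mass_ge[OF G r(1)] by (simp add: f0_def)
    finally have mass: "mass_factor G * exp (- mass_rate G * T) * f0 \<le> int\<Omega> (u r)" .
    have "int\<Omega> (u r) - a * r * int\<Omega> \<xi> = int\<Omega> (\<lambda>x. u r x - a * r * \<xi> x)"
      using L2_integrable[OF u_L2] L2_integrable[OF \<xi>_L2] r by simp
    also have "\<dots> \<le> int\<Omega> (\<lambda>x. max (- gap a r x) 0)"
      using L2_integrable[OF u_L2] L2_integrable[OF \<xi>_L2] r
        L2_integrable[OF E_L2[OF E_pos_part[OF E_uminus[OF gE]]]]
      by (intro integral_mono) (auto simp: gap_def)
    finally have neg: "int\<Omega> (u r) - a * r * int\<Omega> \<xi> \<le> int\<Omega> (\<lambda>x. max (- gap a r x) 0)" .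
    have "a * r * int\<Omega> \<xi> \<le> a * T * (C * measure lebesgue \<Omega>)"
      using a r integral_\<xi>_le integral_nonneg_AE[OF AE_on_\<Omega>I[OF \<xi>_nonneg]]
      by (intro mult_mono mult_left_mono) auto
    with neg mass have neg_ge: "mass_factor G * exp (- mass_rate G * T) * f0 - a * T * (C * measure lebesgue \<Omega>)
        \<le> int\<Omega> (\<lambda>x. max (- gap a r x) 0)"
      by linarith
    have "a * D = \<beta> * (mass_factor G * exp (- mass_rate G * T) * f0)"
      using D by (simp add: a_def slope_def D_def[symmetric])
    then have slope: "a * C + a * T
        = \<beta> * (mass_factor G * exp (- mass_rate G * T) * f0 - a * T * (C * measure lebesgue \<Omega>))"
      by (simp add: D_def algebra_simps)
    have "a * int\<Omega> (\<lambda>x. \<xi> x * ?v x) + a * r * int\<Omega> ?v \<le> (a * C + a * T) * int\<Omega> ?v"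
      using le1 le2 by (simp add: algebra_simps)
    also have "\<dots> \<le> \<beta> * int\<Omega> (\<lambda>x. max (- gap a r x) 0) * int\<Omega> ?v"
      unfolding slope using neg_ge \<beta>_pos v_nonneg by (intro mult_right_mono mult_left_mono) auto
    also have "\<dots> \<le> form (gap a r) ?v"
      by (rule form_pos_part_ge[OF gE])
    finally show "a * int\<Omega> (\<lambda>x. \<xi> x * ?v x) + a * r * int\<Omega> ?v \<le> form (gap a r) ?v" .
  qed (use t T in auto)
  then show ?thesis
    by eventually_elim (simp add: gap_def a_def f0_def T_def ac_simps)
qed

end

text \<open>
  Inside a ball of radius \<open>R\<close> around 0 that contains \<open>\<Omega>\<close> and meets \<open>\<Sigma>\<^sub>1\<close>, distances are at most
  \<open>2 R\<close>.
\<close>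

lemma mixed_domain_exists:
  fixes \<Omega> \<Sigma>1 :: "'a::euclidean_space set"
  assumes s: "0 < s" "s < 1" and \<Omega>: "open \<Omega>" "bounded \<Omega>" "\<Omega> \<noteq> {}"
    and \<Sigma>1: "open \<Sigma>1" "\<Sigma>1 \<noteq> {}" and disj: "\<Omega> \<inter> \<Sigma>1 = {}"
  shows "\<exists>S \<kappa>. mixed_domain s \<Omega> \<Sigma>1 S \<kappa>"
proof -
  obtain R0 where R0: "\<And>x. x \<in> \<Omega> \<Longrightarrow> norm x \<le> R0"
    using \<Omega>(2) by (auto simp: bounded_iff)
  obtain z where z: "z \<in> \<Sigma>1"
    using \<Sigma>1(2) by blast
  define R where "R = max R0 (norm z) + 1"
  define S where "S = \<Sigma>1 \<inter> ball 0 R"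
  define \<kappa> where "\<kappa> = 1 / (2 * R) powr (real DIM('a) + 2 * s)"
  have R: "norm x \<le> R" if "x \<in> \<Omega> \<union> S" for x
    using that R0[of x] by (auto simp: R_def S_def)
  have zR: "norm z < R"
    by (simp add: R_def)
  then have R_pos: "0 < R"
    using norm_ge_zero le_less_trans by blast
  have measure_pos: "0 < measure lebesgue U" if "open U" "bounded U" "U \<noteq> {}" for U :: "'a set"
  proof -
    have "\<not> negligible U"
      using open_not_negligible that by blast
    then have "measure lebesgue U \<noteq> 0"
      using lmeasurable_open[OF that(2,1)] by (simp add: negligible_iff_measure)
    then show ?thesis
      by (simp add: zero_less_measure_iff)
  qed
  have S: "open S" "bounded S" "S \<noteq> {}"
    using \<Sigma>1(1) z zR by (auto simp: S_def intro: bounded_subset[OF bounded_ball])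
  have "mixed_domain s \<Omega> \<Sigma>1 S \<kappa>"
  proof
    show "\<Omega> \<in> lmeasurable" "S \<in> lmeasurable"
      using \<Omega> S by (auto intro: lmeasurable_open)
    show "0 < \<kappa>"
      using R_pos by (simp add: \<kappa>_def)
    show "\<kappa> \<le> frac_kernel s x y" if "x \<in> \<Omega>" "y \<in> \<Omega> \<union> S" "x \<noteq> y" for x y
    proof -
      have "norm (x - y) \<le> 2 * R"
        using norm_triangle_ineq4[of x y] R[of x] R[of y] that by auto
      then have "norm (x - y) powr (real DIM('a) + 2 * s) \<le> (2 * R) powr (real DIM('a) + 2 * s)"
        using s by (intro powr_mono2) auto
      then show ?thesis
        unfolding \<kappa>_def frac_kernel_def using that R_pos by (intro divide_left_mono mult_pos_pos) auto
    qed
  qed (use s disj measure_pos[OF \<Omega>] measure_pos[OF S] in \<open>auto simp: S_def\<close>)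
  then show ?thesis
    by blast
qed

lemma (in mixed_domain) heat_flowI:
  assumes "elliptic_solution s \<Omega> \<Sigma>1 \<xi>" "u0 \<in> L2 \<Omega>" "AE x in lebesgue_on \<Omega>. 0 \<le> u0 x"
    and "parabolic_solution s \<Omega> \<Sigma>1 u0 u"
  shows "\<exists>ut. heat_flow s \<Omega> \<Sigma>1 S \<kappa> u0 u ut \<xi>"
proof -
  obtain ut where ut: "curve_cont {0<..} (L2 \<Omega>) (L2_normsq \<Omega>) ut"
      "\<forall>t>0. L2_curve_deriv \<Omega> u (ut t) t"
      "\<forall>\<tau>>0. \<forall>\<phi>. curve_cont {0<..} E (E_normsq s \<Omega>) \<phi> \<longrightarrow>
           int\<Omega> (\<lambda>x. ut \<tau> x * \<phi> \<tau> x) + form (u \<tau>) (\<phi> \<tau>) = 0"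
    using assms(4) by (auto simp: parabolic_solution_def)
  have const: "curve_cont {0<..} E (E_normsq s \<Omega>) (\<lambda>_. \<phi>)" if "\<phi> \<in> E" for \<phi>
    using that by (simp add: curve_cont_def E_normsq_def L2_normsq_def)
  have "heat_flow s \<Omega> \<Sigma>1 S \<kappa> u0 u ut \<xi>"
  proof
    show "int\<Omega> (\<lambda>x. ut t x * \<phi> x) = - form (u t) \<phi>" if "0 < t" "\<phi> \<in> E" for t \<phi>
      using ut(3)[rule_format, OF that(1) const[OF that(2)]] by simp
  qed (use assms ut in \<open>auto simp: parabolic_solution_def curve_cont_def\<close>)
  then show ?thesis
    by blast
qed

theorem theorem1p2:
  fixes s :: real and \<Omega> \<Sigma>1 \<Sigma>2 :: "'a::euclidean_space set"
  assumes "0 < s" and "s < 1"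
    and "open \<Omega>" and "connected \<Omega>" and "\<Omega> \<noteq> {}" and "bounded \<Omega>"
    and "open \<Sigma>1" and "open \<Sigma>2"
    and "emeasure lebesgue \<Sigma>1 > 0" and "emeasure lebesgue \<Sigma>2 > 0"
    and "\<Sigma>1 \<inter> \<Sigma>2 = {}"
    and "closure \<Sigma>1 \<union> closure \<Sigma>2 = UNIV - \<Omega>"
  shows "\<exists>c :: real \<Rightarrow> real. (\<forall>t>0. c t > 0) \<and>
    (\<forall>\<xi>. elliptic_solution s \<Omega> \<Sigma>1 \<xi> \<longrightarrow>
      (\<forall>u0 u. u0 \<in> L2 \<Omega> \<longrightarrow> (AE x in lebesgue_on \<Omega>. u0 x \<ge> 0) \<longrightarrow>
        parabolic_solution s \<Omega> \<Sigma>1 u0 u \<longrightarrow>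
        (\<forall>t>0. AE x in lebesgue_on \<Omega>.
           u t x \<ge> c t * (LINT y|lebesgue_on \<Omega>. u0 y * \<xi> y) * \<xi> x)))"
proof -
  have "\<Sigma>1 \<noteq> {}"
    using assms(9) by auto
  moreover have "\<Omega> \<inter> \<Sigma>1 = {}"
    using assms(12) closure_subset[of \<Sigma>1] by blast
  ultimately obtain S \<kappa> where "mixed_domain s \<Omega> \<Sigma>1 S \<kappa>"
    using mixed_domain_exists[of s \<Omega> \<Sigma>1] assms by blast
  then interpret mixed_domain s \<Omega> \<Sigma>1 S \<kappa> .
  \<comment> \<open>By uniqueness of the elliptic solution, its norm is a constant of the domain.\<close>
  obtain g where g: "\<And>\<xi>. elliptic_solution s \<Omega> \<Sigma>1 \<xi> \<Longrightarrow> int\<Omega> (\<lambda>x. (\<xi> x)\<^sup>2) = g"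
  proof (cases "\<exists>\<zeta>. elliptic_solution s \<Omega> \<Sigma>1 \<zeta>")
    case True
    then obtain \<zeta> where \<zeta>: "elliptic_solution s \<Omega> \<Sigma>1 \<zeta>" ..
    have "int\<Omega> (\<lambda>x. (\<xi> x)\<^sup>2) = int\<Omega> (\<lambda>x. (\<zeta> x)\<^sup>2)" if \<xi>: "elliptic_solution s \<Omega> \<Sigma>1 \<xi>" for \<xi>
    proof (rule Bochner_Integration.integral_cong_AE)
      show "AE x in lebesgue_on \<Omega>. (\<xi> x)\<^sup>2 = (\<zeta> x)\<^sup>2"
        using AE_on_\<Omega>I[OF elliptic_unique[OF \<xi> \<zeta>]] by eventually_elim simp
    qed (use \<xi> \<zeta> in \<open>auto simp: elliptic_solution_def dest!: E_L2 L2_integrable_square\<close>)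
    then show ?thesis
      by (rule that)
  qed (use that in blast)
  \<comment> \<open>If \<open>g = 0\<close>, then \<open>\<xi>\<close> vanishes on \<open>\<Omega>\<close> and positivity of \<open>u\<close> is enough.\<close>
  define c where "c t = (if 0 < g then slope g (t + 1) * t else 1)" for t
  show ?thesis
  proof (intro exI[of _ c] conjI allI impI)
    show "0 < c t" if "0 < t" for t
      using that slope_pos[of g "t + 1"] by (simp add: c_def)
    fix \<xi> u0 u and t :: real
    assume \<xi>: "elliptic_solution s \<Omega> \<Sigma>1 \<xi>" and u0: "u0 \<in> L2 \<Omega>" "AE x in lebesgue_on \<Omega>. 0 \<le> u0 x"
      and u: "parabolic_solution s \<Omega> \<Sigma>1 u0 u" and t: "0 < t"
    obtain ut where "heat_flow s \<Omega> \<Sigma>1 S \<kappa> u0 u ut \<xi>"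
      using heat_flowI[OF \<xi> u0 u] by blast
    then interpret flow: heat_flow s \<Omega> \<Sigma>1 S \<kappa> u0 u ut \<xi> .
    have G: "flow.G = g"
      using g[OF \<xi>] by (simp add: flow.G_def)
    show "AE x in lebesgue_on \<Omega>. c t * int\<Omega> (\<lambda>y. u0 y * \<xi> y) * \<xi> x \<le> u t x"
    proof (cases "0 < g")
      case True
      then show ?thesis
        using flow.solution_ge[of t] t by (simp add: c_def G)
    next
      case False
      then have "AE x in lebesgue_on \<Omega>. \<xi> x = 0"
        using g[OF \<xi>] by (intro zero_on_\<Omega> flow.\<xi>_E) simp
      then show ?thesis
        using flow.u_nonneg[OF less_imp_le[OF t]] by eventually_elim simp
    qed
  qed
qed

end
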